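(* Let $(S,\mathcal{S},\mu)$ be an atomless measure space and $\xi$ a $\mu$-exchangeable random measure on $S$. (i) For each $\xi$-integrable $\mu$-sequence $(A_n)_{n\ge1}$ there exists a random variable $X$ such that $\xi(A_n)/\mu(A_n)\to X$ almost surely and in $L^1$ as $n\to\infty$. (ii) Assume that $\mu$ is $\sigma$-finite and that there is $C\in\mathcal{S}$ with $\mu(C)\in(0,\infty)$ and $\mathbf{E}\,\xi(C)<\infty$. Then the limit $X$ in (i) is unique for all $\mu$-sequences, i.e. up to almost sure equality it is the same random variable for every $\mu$-sequence.
   Context: A random measure $\xi$ on a measurable space $(S,\mathcal{S})$, defined over a probability space $(\Omega,\mathcal{F},\mathbf{P})$, is a map $\xi:\Omega\times\mathcal{S}\to[0,\infty]$ such that $\xi(M)=\xi(\cdot,M)$ is measurable for each $M\in\mathcal{S}$ and $\xi(\omega,\cdot)$ is a measure for each $\omega\in\Omega$. Atomless: an atom of $\mu$ is a measurable set $M$ with $\mu(M)>0$ such that every measurable $C\subset M$ satisfies $\mu(C)=0$ or $\mu(C)=\mu(M)$; $\mu$ is atomless if it has no atoms. $\mu$-exchangeable: $(\xi(A_1),\dots,\xi(A_n))$ and $(\xi(B_1),\dots,\xi(B_n))$ are equal in distribution for all $n\ge 1$, all disjoint $A_1,\dots,A_n\in\mathcal{S}$ and all disjoint $B_1,\dots,B_n\in\mathcal{S}$ with $\mu(A_j)=\mu(B_j)$ for $1\le j\le n$. A $\mu$-sequence is an increasing sequence $A_n\in\mathcal{S}$ ($n\ge1$) with $\mu(A_n)<\infty$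 for all $n$ and $\mu(A_n)\to\infty$. It is $\xi$-integrable if $\mathbf{E}\,\xi(A_n)<\infty$ for all $n\ge1$. (Under the conditions of (ii), every $\mu$-sequence is $\xi$-integrable.) *)

theory Defs
  imports "HOL-Probability.Probability"
begin

definition measure_atom :: "'a measure \<Rightarrow> 'a set \<Rightarrow> bool" where
  "measure_atom M A \<longleftrightarrow> A \<in> sets M \<and> emeasure M A > 0 \<and>
     (\<forall>C\<in>sets M. C \<subseteq> A \<longrightarrow> emeasure M C = 0 \<or> emeasure M C = emeasure M A)"

definition atomless :: "'a measure \<Rightarrow> bool" where
  "atomless M \<longleftrightarrow> (\<nexists>A. measure_atom M A)"

(* Only the sigma-algebra of M is used.  The measures \<xi> \<omega> are arbitrary: they are not assumed
   finite or sigma-finite, so the (sub)probability kernels of the library do not apply. *)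
definition random_measure :: "'w measure \<Rightarrow> 'a measure \<Rightarrow> ('w \<Rightarrow> 'a measure) \<Rightarrow> bool" where
  "random_measure P M \<xi> \<longleftrightarrow>
     (\<forall>\<omega>\<in>space P. sets (\<xi> \<omega>) = sets M) \<and>
     (\<forall>A\<in>sets M. (\<lambda>\<omega>. emeasure (\<xi> \<omega>) A) \<in> borel_measurable P)"

(* The law of (\<xi>(A 0), ..., \<xi>(A (n - 1))), a measure on [0,\<infinity>]^n. *)
definition joint_law ::
  "'w measure \<Rightarrow> ('w \<Rightarrow> 'a measure) \<Rightarrow> nat \<Rightarrow> (nat \<Rightarrow> 'a set) \<Rightarrow> (nat \<Rightarrow> ennreal) measure" where
  "joint_law P \<xi> n A =
     distr P (\<Pi>\<^sub>M i\<in>{..<n}. borel) (\<lambda>\<omega>. \<lambda>i\<in>{..<n}. emeasure (\<xi> \<omega>) (A i))"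

definition exchangeable :: "'w measure \<Rightarrow> 'a measure \<Rightarrow> ('w \<Rightarrow> 'a measure) \<Rightarrow> bool" where
  "exchangeable P M \<xi> \<longleftrightarrow>
     (\<forall>n\<ge>1. \<forall>A B.
        (\<forall>i<n. A i \<in> sets M) \<and> disjoint_family_on A {..<n} \<and>
        (\<forall>i<n. B i \<in> sets M) \<and> disjoint_family_on B {..<n} \<and>
        (\<forall>i<n. emeasure M (A i) = emeasure M (B i))
        \<longrightarrow> joint_law P \<xi> n A = joint_law P \<xi> n B)"

definition measure_sequence :: "'a measure \<Rightarrow> (nat \<Rightarrow> 'a set) \<Rightarrow> bool" where
  "measure_sequence M A \<longleftrightarrow>
     (\<forall>n. A n \<in> sets M) \<and> incseq A \<and> (\<forall>n. emeasure M (A n) < \<infinity>) \<and>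
     (\<lambda>n. emeasure M (A n)) \<longlonglongrightarrow> \<infinity>"

definition integrable_sequence ::
  "'w measure \<Rightarrow> ('w \<Rightarrow> 'a measure) \<Rightarrow> (nat \<Rightarrow> 'a set) \<Rightarrow> bool" where
  "integrable_sequence P \<xi> A \<longleftrightarrow> (\<forall>n. (\<integral>\<^sup>+\<omega>. emeasure (\<xi> \<omega>) (A n) \<partial>P) < \<infinity>)"

(* Real-valued ratio \<xi>(A)/\<mu>(A).  It is used only for sets A with finite expected \<xi>(A), hence with
   \<xi>(A) almost surely finite, so replacing the value \<infinity> by 0 changes it only on a null set.
   If \<mu>(A) = 0, possible for finitely many members of a sequence, it is 0. *)
definition average :: "'a measure \<Rightarrow> ('w \<Rightarrow> 'a measure) \<Rightarrow> 'a set \<Rightarrow> 'w \<Rightarrow> real" where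
  "average M \<xi> A \<omega> = measure (\<xi> \<omega>) A / measure M A"

definition converges_AE_L1 ::
  "'w measure \<Rightarrow> (nat \<Rightarrow> 'w \<Rightarrow> real) \<Rightarrow> ('w \<Rightarrow> real) \<Rightarrow> bool" where
  "converges_AE_L1 P Y X \<longleftrightarrow>
     (AE \<omega> in P. (\<lambda>n. Y n \<omega>) \<longlonglongrightarrow> X \<omega>) \<and>
     (\<forall>n. integrable P (Y n)) \<and> integrable P X \<and>
     (\<lambda>n. \<integral>\<omega>. \<bar>Y n \<omega> - X \<omega>\<bar> \<partial>P) \<longlonglongrightarrow> 0"

end

theory Submission
  imports Defs
begin

text \<open>By exchangeability, for a bounded function h of the values of \<xi> on a chain of sets, the map
  sending A to the expectation of h \<cdot> \<xi>(A) is additive and depends only on \<mu>(A) for A below the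
  chain; as \<mu> is atomless it is therefore proportional to \<mu>(A). This says that the averages
  \<xi>(A)/\<mu>(A) form a reversed martingale along increasing sets. Doob's maximal inequality then
  reduces almost sure convergence to the Cauchy property in L1. The latter comes from a rate that
  depends only on \<mu>(A): the averages over p and over r > p disjoint sets of equal measure differ in
  L1 by at most 2 \<delta> + K/sqrt p, where \<delta> is the cost of truncating one summand at level K. As the
  rate holds for all pairs of nested sets, the limits along A and B both equal the limit along
  A \<union> B, which gives uniqueness.\<close>

section \<open>Subsets of prescribed measure in atomless measure spaces\<close>

text \<open>Three obstacles shape the proof: \<xi>(A) is only known to have a finite mean, disjoint
  sets need not have independent values, and the sets of a sequence have arbitrary measures. Since
  second moments may be infinite, summands are truncated before a variance is computed, and the
  level K is fixed before the number p of pieces. Since the limit is random, averages are compared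
  with each other and not with a mean. The rate does not contain r, so it is uniform over all larger
  sets; this serves both convergence and the comparison of two sequences. Conditioning is replaced
  by test functions h of finitely many values of \<xi>, whose expectations are determined by the
  joint laws in the definition of exchangeability. With h the sign of a deviation this gives a
  contraction in L1; with that sign restricted to the event that an index is the last one with a
  large deviation it gives the maximal inequality. A set \<open>U\<close> of positive finite measure
  and finite expectation is the unit: the pieces in the rate have the measure of \<open>U\<close>,
  and integrability spreads from \<open>U\<close> to all sets of finite measure.\<close>

text \<open>A set that is not an atom splits into two parts of positive measure, one of which has at
  most half the measure of the whole. Iterating the halving gets below any \<open>e\<close>.\<close>

lemma atomless_small_subset:
  assumes "atomless M" and A: "A \<in> fmeasurable M" "measure M A > 0" and "e > 0"
  shows "\<exists>B\<in>sets M. B \<subseteq> A \<and> 0 < measure M B \<and> measure M B \<le> e"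
proof -
  have halve: "\<exists>C\<in>sets M. C \<subseteq> B \<and> 0 < measure M C \<and> measure M C \<le> measure M B / 2"
    if B: "B \<in> fmeasurable M" "measure M B > 0" for B
  proof -
    have "\<not> measure_atom M B"
      using assms(1) by (auto simp: atomless_def)
    moreover have "B \<in> sets M" "emeasure M B > 0"
      using B by (auto simp: measure_def intro: gr_zeroI)
    ultimately obtain C where C: "C \<in> sets M" "C \<subseteq> B" "emeasure M C \<noteq> 0" "emeasure M C \<noteq> emeasure M B"
      by (auto simp: measure_atom_def)
    have Cf: "C \<in> fmeasurable M"
      using B C by (metis fmeasurableI2)
    have diff: "measure M (B - C) = measure M B - measure M C"
      using B(1) C Cf by (metis measurable_measure_Diff fmeasurableD)
    have "measure M C \<noteq> 0" "measure M C \<noteq> measure M B"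
      using C(3,4) emeasure_eq_measure2[OF B(1)] emeasure_eq_measure2[OF Cf] by auto
    moreover have "measure M C \<le> measure M B"
      using measure_nonneg[of M "B - C"] diff by linarith
    ultimately have lt: "0 < measure M C" "measure M C < measure M B"
      by (auto simp: zero_less_measure_iff)
    show ?thesis
    proof (cases "measure M C \<le> measure M B / 2")
      case True
      then show ?thesis using C lt by blast
    next
      case False
      then have "0 < measure M (B - C)" "measure M (B - C) \<le> measure M B / 2"
        using diff lt by auto
      moreover have "B - C \<in> sets M" "B - C \<subseteq> B" using fmeasurableD[OF B(1)] C(1) by auto
      ultimately show ?thesis by blast
    qed
  qed
  have pow: "\<exists>B\<in>sets M. B \<subseteq> A \<and> 0 < measure M B \<and> measure M B \<le> measure M A / 2 ^ n" for n
  proof (induction n)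
    case 0
    then show ?case using A by auto
  next
    case (Suc n)
    then obtain B where B: "B \<in> sets M" "B \<subseteq> A" "0 < measure M B" "measure M B \<le> measure M A / 2 ^ n"
      by auto
    then have "B \<in> fmeasurable M" using A by (metis fmeasurableI2)
    from halve[OF this B(3)] obtain C where
      "C\<in>sets M" "C \<subseteq> B" "0 < measure M C" "measure M C \<le> measure M B / 2"
      by auto
    moreover have "measure M B / 2 \<le> measure M A / 2 ^ n / 2"
      using B(4) by (rule divide_right_mono) simp
    ultimately have "C \<in> sets M" "C \<subseteq> B" "0 < measure M C" "measure M C \<le> measure M A / 2 ^ Suc n"
      by (simp_all add: mult.commute)
    then show ?case using B(2) by blast
  qed
  have "(\<lambda>n. measure M A / 2 ^ n) \<longlonglongrightarrow> 0" by real_asymp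
  from order_tendstoD(2)[OF this \<open>e > 0\<close>] obtain n where "measure M A / 2 ^ n < e"
    by (metis eventually_sequentially order_refl)
  with pow[of n] show ?thesis by (meson less_imp_le order_trans)
qed

text \<open>Greedy exhaustion: each stage adds an admissible piece of at least half the largest
  possible measure, and the union of all stages is the desired set.\<close>

lemma atomless_subset_of_measure:
  assumes atl: "atomless M" and A: "A \<in> fmeasurable M" and t: "0 \<le> t" "t \<le> measure M A"
  shows "\<exists>B\<in>sets M. B \<subseteq> A \<and> measure M B = t"
proof -
  \<comment> \<open>\<open>F B\<close> holds the pieces that may still be added to \<open>B\<close>:
    disjoint from it and not pushing the measure above \<open>t\<close>.\<close>
  define F where "F B = {E\<in>sets M. E \<subseteq> A - B \<and> measure M B + measure M E \<le> t}" for B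
  have fm: "B \<in> fmeasurable M" if "B \<in> sets M" "B \<subseteq> A" for B
    using that A by (metis fmeasurableI2)
  have fin: "emeasure M B \<noteq> \<infinity>" if "B \<in> sets M" "B \<subseteq> A" for B
    using fm[OF that] by (simp add: fmeasurableD2)
  \<comment> \<open>The supremum of the admissible measures need not be attained, hence the factor
    2; if it is 0, the empty piece will do.\<close>
  have greedy: "\<exists>E\<in>F B. \<forall>E'\<in>F B. measure M E' \<le> 2 * measure M E" if "measure M B \<le> t" for B
  proof -
    have emp: "{} \<in> F B" using that by (auto simp: F_def)
    have bdd: "bdd_above (measure M ` F B)"
    proof (rule bdd_aboveI2)
      show "measure M E \<le> t" if "E \<in> F B" for E
        using that measure_nonneg[of M B] unfolding F_def mem_Collect_eq by linarith
    qed
    let ?s = "SUP E\<in>F B. measure M E"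
    have upper: "measure M E \<le> ?s" if "E \<in> F B" for E
      using that bdd by (rule cSUP_upper)
    show ?thesis
    proof (cases "?s \<le> 0")
      case True
      have "\<forall>E'\<in>F B. measure M E' \<le> 2 * measure M {}"
        using upper True by force
      with emp show ?thesis by blast
    next
      case False
      then have "?s / 2 < ?s" by simp
      then obtain E where "E \<in> F B" "?s / 2 < measure M E"
        using emp bdd by (subst (asm) less_cSUP_iff) auto
      then show ?thesis using upper by (intro bexI[of _ E] ballI) force+
    qed
  qed
  have "\<exists>B. \<forall>n. (B n \<in> sets M \<and> B n \<subseteq> A \<and> measure M (B n) \<le> t) \<and>
          (\<exists>E\<in>F (B n). (\<forall>E'\<in>F (B n). measure M E' \<le> 2 * measure M E) \<and> B (Suc n) = B n \<union> E)"
  proof (rule dependent_nat_choice)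
    show "\<exists>B. B \<in> sets M \<and> B \<subseteq> A \<and> measure M B \<le> t"
      using t by (intro exI[of _ "{}"]) auto
  next
    fix B and n :: nat
    assume B: "B \<in> sets M \<and> B \<subseteq> A \<and> measure M B \<le> t"
    then obtain E where E: "E\<in>F B" "\<forall>E'\<in>F B. measure M E' \<le> 2 * measure M E"
      using greedy by blast
    have E': "E \<in> sets M" "E \<subseteq> A" "B \<inter> E = {}" "measure M B + measure M E \<le> t"
      using E(1) by (auto simp: F_def)
    have "measure M (B \<union> E) = measure M B + measure M E"
      using E' B by (intro measure_Union fin) auto
    then have "B \<union> E \<in> sets M \<and> B \<union> E \<subseteq> A \<and> measure M (B \<union> E) \<le> t"
      using B E' by auto
    with E show "\<exists>B'. (B' \<in> sets M \<and> B' \<subseteq> A \<and> measure M B' \<le> t) \<and>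
        (\<exists>E\<in>F B. (\<forall>E'\<in>F B. measure M E' \<le> 2 * measure M E) \<and> B' = B \<union> E)"
      by blast
  qed
  then obtain B where B: "\<And>n. B n \<in> sets M" "\<And>n. B n \<subseteq> A" "\<And>n. measure M (B n) \<le> t"
    and step: "\<And>n. \<exists>E\<in>F (B n). (\<forall>E'\<in>F (B n). measure M E' \<le> 2 * measure M E) \<and> B (Suc n) = B n \<union> E"
    by blast
  let ?U = "\<Union>n. B n"
  have U: "?U \<in> sets M" "?U \<subseteq> A" using B by auto
  have inc: "incseq B" using step by (intro incseq_SucI) blast
  have lim: "(\<lambda>n. measure M (B n)) \<longlonglongrightarrow> measure M ?U"
    using fm[OF U] B inc by (intro Lim_measure_incseq) (auto simp: fmeasurable_def)
  have Ut: "measure M ?U \<le> t" using B(3) by (intro LIMSEQ_le_const2[OF lim]) auto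
  have "measure M ?U = t"
  proof (rule ccontr)
    assume "measure M ?U \<noteq> t"
    then have lt: "measure M ?U < t" using Ut by simp
    have rest: "A - ?U \<in> fmeasurable M" using A U by (intro fmeasurable.Diff fm[OF U])
    have "measure M (A - ?U) = measure M A - measure M ?U"
      by (rule measurable_measure_Diff[OF A U])
    then have "measure M (A - ?U) > 0" using lt t by simp
    then obtain E where E: "E \<in> sets M" "E \<subseteq> A - ?U" "0 < measure M E" "measure M E \<le> t - measure M ?U"
      using atomless_small_subset[OF atl rest, of "t - measure M ?U"] lt by auto
    \<comment> \<open>\<open>E\<close> avoids the whole union and fits into its deficit, so it was a
      candidate at every stage. Every stage therefore gained at least half its measure, which is
      impossible below the bound \<open>t\<close>.\<close>
    have EF: "E \<in> F (B n)" for n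
    proof -
      have "measure M (B n) \<le> measure M ?U"
        using B by (intro measure_mono_fmeasurable fm U) auto
      with E show ?thesis by (auto simp: F_def)
    qed
    have grow: "measure M (B n) \<ge> n * (measure M E / 2)" for n
    proof (induction n)
      case (Suc n)
      obtain E' where E': "E' \<in> F (B n)" "measure M E \<le> 2 * measure M E'" "B (Suc n) = B n \<union> E'"
        using step[of n] EF[of n] by blast
      have "E' \<in> sets M" "E' \<subseteq> A" "B n \<inter> E' = {}"
        using E'(1) by (auto simp: F_def)
      then have "measure M (B n \<union> E') = measure M (B n) + measure M E'"
        using B by (intro measure_Union fin) auto
      with Suc E' show ?case by (simp add: algebra_simps)
    qed simp
    obtain n :: nat where "n * (measure M E / 2) > t"
      using reals_Archimedean3[of "measure M E / 2"] E(3) by auto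
    with grow[of n] B(3)[of n] show False by simp
  qed
  with U show ?thesis by blast
qed

text \<open>Pieces are carved off one at a time, the last being all that remains. The case
  \<open>r = 0\<close> is excluded because a nonempty null set is not an empty union.\<close>

lemma atomless_partition:
  assumes atl: "atomless M" and "1 \<le> r" and D: "D \<in> fmeasurable M" "measure M D = real r * u"
    and u: "0 \<le> u"
  shows "\<exists>V. (\<forall>i<r. V i \<in> fmeasurable M \<and> measure M (V i) = u) \<and>
           disjoint_family_on V {..<r} \<and> (\<Union>i<r. V i) = D"
  using assms(2) D
proof (induction r arbitrary: D rule: nat_induct_at_least)
  case base
  then show ?case by (intro exI[of _ "\<lambda>_. D"]) (auto simp: disjoint_family_on_def)
next
  case (Suc r)
  have "u \<le> measure M D" using u by (simp add: Suc.prems algebra_simps)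
  then obtain E where E: "E \<in> sets M" "E \<subseteq> D" "measure M E = u"
    using atomless_subset_of_measure[OF atl Suc.prems(1) u] by blast
  have Ef: "E \<in> fmeasurable M" using E Suc.prems by (metis fmeasurableI2)
  have "measure M (D - E) = measure M D - measure M E"
    using Suc.prems Ef E by (intro measurable_measure_Diff) auto
  then have "measure M (D - E) = real r * u" "D - E \<in> fmeasurable M"
    using Suc.prems E by (auto simp: algebra_simps fmeasurable.Diff Ef)
  then obtain V where V: "\<forall>i<r. V i \<in> fmeasurable M \<and> measure M (V i) = u"
    "disjoint_family_on V {..<r}" "(\<Union>i<r. V i) = D - E"
    using Suc.IH by metis
  have "disjoint_family_on (V(r := E)) {..<Suc r}"
    using V(2,3) unfolding disjoint_family_on_def by (fastforce simp: less_Suc_eq)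
  moreover have "(\<Union>i<Suc r. (V(r := E)) i) = D"
    using V(3) E(2) by (auto simp: lessThan_Suc)
  moreover have "\<forall>i<Suc r. (V(r := E)) i \<in> fmeasurable M \<and> measure M ((V(r := E)) i) = u"
    using V(1) E Ef by (auto simp: less_Suc_eq)
  ultimately show ?case by blast
qed

text \<open>Cut \<open>B\<close> into \<open>q\<close> pieces of equal measure, on which
  \<open>G\<close> takes a single value by \<open>inv\<close>. Filling a subset \<open>E\<close>
  with as many pieces of that size as fit gives, by additivity and monotonicity, a lower bound for
  \<open>G E\<close> that tends to its proportional share of \<open>G B\<close> as \<open>q\<close>
  grows.\<close>

lemma additive_invariant_imp_proportional:
  fixes G :: "'a set \<Rightarrow> real"
  assumes atl: "atomless M" and B: "B \<in> fmeasurable M" and A: "A \<in> sets M" "A \<subseteq> B"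
    and nonneg: "\<And>E. E \<in> sets M \<Longrightarrow> E \<subseteq> B \<Longrightarrow> 0 \<le> G E"
    and add: "\<And>E F. E \<in> sets M \<Longrightarrow> F \<in> sets M \<Longrightarrow> E \<subseteq> B \<Longrightarrow> F \<subseteq> B \<Longrightarrow> E \<inter> F = {} \<Longrightarrow>
      G (E \<union> F) = G E + G F"
    and inv: "\<And>E F. E \<in> sets M \<Longrightarrow> F \<in> sets M \<Longrightarrow> E \<subseteq> B \<Longrightarrow> F \<subseteq> B \<Longrightarrow>
      measure M E = measure M F \<Longrightarrow> G E = G F"
  shows "measure M B * G A = measure M A * G B"
proof (cases "measure M B = 0")
  case True
  have "measure M A \<le> measure M B" using A B by (intro measure_mono_fmeasurable) auto
  then show ?thesis using True measure_nonneg[of M A] by auto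
next
  case False
  then have b: "measure M B > 0" by (simp add: zero_less_measure_iff)
  have fm: "E \<in> fmeasurable M" if "E \<in> sets M" "E \<subseteq> B" for E
    using that B by (metis fmeasurableI2)
  have G0: "G {} = 0" using add[of "{}" "{}"] by simp
  have mono: "G E \<le> G F" if "E \<in> sets M" "F \<in> sets M" "E \<subseteq> F" "F \<subseteq> B" for E F
  proof -
    have "G (E \<union> (F - E)) = G E + G (F - E)" using that by (intro add) auto
    moreover have "0 \<le> G (F - E)" using that by (intro nonneg) auto
    moreover have "E \<union> (F - E) = F" using that by auto
    ultimately show ?thesis by simp
  qed
  have pieces: "G (\<Union>i<n. V i) = real n * g"
    if V: "\<And>i. i < n \<Longrightarrow> V i \<in> sets M \<and> V i \<subseteq> B \<and> G (V i) = g" "disjoint_family_on V {..<n}"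
    for V n g
    using that
  proof (induction n)
    case (Suc n)
    have V: "V i \<in> sets M" "V i \<subseteq> B" if "i \<le> n" for i
      using Suc.prems(1)[of i] that by auto
    have "V i \<inter> V n = {}" if "i < n" for i
      using disjoint_family_onD[OF Suc.prems(2), of i n] that by simp
    then have "(\<Union>i<n. V i) \<inter> V n = {}" by auto
    moreover have "(\<Union>i<n. V i) \<in> sets M"
      using V by (intro sets.finite_UN) auto
    moreover have "(\<Union>i<n. V i) \<subseteq> B"
      using V(2) by (intro UN_least) simp
    ultimately have "G ((\<Union>i<n. V i) \<union> V n) = G (\<Union>i<n. V i) + G (V n)"
      using V[of n] by (intro add) auto
    moreover have "G (\<Union>i<n. V i) = real n * g"
      using Suc.prems by (intro Suc.IH) (auto simp: disjoint_family_on_def)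
    ultimately show ?case
      using Suc.prems(1)[of n] by (simp add: lessThan_Suc Un_commute algebra_simps)
  qed (use G0 in simp)
  have lower: "measure M E / measure M B * G B \<le> G E" if E: "E \<in> sets M" "E \<subseteq> B" for E
  proof -
    have q: "(measure M E / measure M B - 1 / real q) * G B \<le> G E" if "q \<ge> 1" for q :: nat
    proof -
      define u where "u = measure M B / q"
      have u: "0 < u" and mB: "measure M B = real q * u" using b that by (simp_all add: u_def)
      obtain V where V: "\<forall>i<q. V i \<in> fmeasurable M \<and> measure M (V i) = u"
           "disjoint_family_on V {..<q}" "(\<Union>i<q. V i) = B"
        using atomless_partition[OF atl \<open>q \<ge> 1\<close> B mB] u by auto
      have V0: "V 0 \<in> sets M" "V 0 \<subseteq> B" "measure M (V 0) = u"
        using V(1,3) that by (auto dest: fmeasurableD)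
      have "G (\<Union>i<q. V i) = real q * G (V 0)"
      proof (intro pieces conjI)
        fix i assume "i < q"
        then show i: "V i \<in> sets M" "V i \<subseteq> B" using V by (auto dest: fmeasurableD)
        show "G (V i) = G (V 0)" using i V0 V(1) \<open>i < q\<close> by (intro inv) simp_all
      qed (use V in auto)
      then have GB: "G B = real q * G (V 0)" using V(3) by simp
      \<comment> \<open>The number of pieces of measure \<open>u\<close> that fit into
        \<open>E\<close>. Rounding down loses at most one piece, that is
        \<open>G B / q\<close>.\<close>
      define p where "p = nat \<lfloor>q * measure M E / measure M B\<rfloor>"
      have p: "real p \<le> q * measure M E / measure M B" "q * measure M E / measure M B \<le> real p + 1"
        using b by (auto simp: p_def of_nat_nat)
      have "real p * G (V 0) \<le> G E"
      proof (cases "p \<ge> 1")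
        case True
        have "real p * u \<le> measure M E" using p(1) that b by (simp add: u_def field_simps)
        then obtain E' where E': "E' \<in> sets M" "E' \<subseteq> E" "measure M E' = real p * u"
          using atomless_subset_of_measure[OF atl fm[OF E], of "real p * u"] u by auto
        have "E' \<in> fmeasurable M" using fm[OF E'(1)] E'(2) E(2) by blast
        then obtain W where W: "\<forall>i<p. W i \<in> fmeasurable M \<and> measure M (W i) = u"
           "disjoint_family_on W {..<p}" "(\<Union>i<p. W i) = E'"
          using atomless_partition[OF atl True _ E'(3) less_imp_le[OF u]] by blast
        have "G (\<Union>i<p. W i) = real p * G (V 0)"
        proof (intro pieces conjI)
          fix i assume "i < p"
          then show i: "W i \<in> sets M" "W i \<subseteq> B" using W E E' by (auto dest: fmeasurableD)
          show "G (W i) = G (V 0)" using i V0 W(1) \<open>i < p\<close> by (intro inv) simp_all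
        qed (use W in auto)
        then show ?thesis using mono[OF E'(1) E(1) E'(2) E(2)] W(3) by simp
      next
        case False
        then show ?thesis using nonneg[OF E] by (cases p) simp_all
      qed
      moreover have "(measure M E / measure M B - 1 / real q) * G B
          = (q * measure M E / measure M B - 1) * G (V 0)"
        using that by (simp add: GB algebra_simps)
      moreover have "\<dots> \<le> real p * G (V 0)"
        using p(2) nonneg[OF V0(1,2)] by (intro mult_right_mono) auto
      ultimately show ?thesis by linarith
    qed
    have "(\<lambda>q. (measure M E / measure M B - 1 / real q) * G B) \<longlonglongrightarrow> (measure M E / measure M B - 0) * G B"
      by (intro tendsto_intros lim_1_over_n)
    from LIMSEQ_le_const2[OF this, of "G E"] q show ?thesis by auto
  qed
  \<comment> \<open>The lower bounds for \<open>A\<close> and \<open>B - A\<close> already add up to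
    \<open>G B\<close>, so both are equalities and no upper bound has to be proved.\<close>
  have "G (A \<union> (B - A)) = G A + G (B - A)" using A B by (intro add) auto
  moreover have "A \<union> (B - A) = B" using A by auto
  moreover have "measure M (B - A) = measure M B - measure M A"
    by (rule measurable_measure_Diff[OF B A])
  moreover have "measure M A / measure M B * G B \<le> G A"
    using lower A by blast
  moreover have "measure M (B - A) / measure M B * G B \<le> G (B - A)"
    using lower[of "B - A"] A B by auto
  moreover have "(measure M B - measure M A) / measure M B * G B = G B - measure M A / measure M B * G B"
    using b by (simp add: field_simps)
  ultimately have "G A = measure M A / measure M B * G B" by simp
  then show ?thesis using b by simp
qed

section \<open>Weighted sums and maximal inequalities in a probability space\<close>

context prob_space
begin

lemma integrable_bounded_mult:
  fixes h f :: "'a \<Rightarrow> real"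
  assumes [measurable]: "h \<in> borel_measurable M" and h: "\<And>x. \<bar>h x\<bar> \<le> K" and f: "integrable M f"
  shows "integrable M (\<lambda>x. h x * f x)"
proof (rule Bochner_Integration.integrable_bound)
  show "integrable M (\<lambda>x. K * f x)" by (intro integrable_mult_right f)
  show "AE x in M. norm (h x * f x) \<le> norm (K * f x)"
    using h order_trans[OF abs_ge_zero h] by (auto simp: abs_mult intro!: mult_right_mono)
qed (use f in measurable)

lemma expectation_abs_le_sqrt:
  fixes Z :: "'a \<Rightarrow> real"
  assumes Z: "integrable M Z" and Z2: "integrable M (\<lambda>x. (Z x)\<^sup>2)"
  shows "expectation (\<lambda>x. \<bar>Z x\<bar>) \<le> sqrt (expectation (\<lambda>x. (Z x)\<^sup>2))"
proof (rule real_le_rsqrt)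
  have "variance (\<lambda>x. \<bar>Z x\<bar>) = expectation (\<lambda>x. \<bar>Z x\<bar>\<^sup>2) - (expectation (\<lambda>x. \<bar>Z x\<bar>))\<^sup>2"
    using Z Z2 by (intro variance_eq integrable_abs) (simp_all add: power2_abs)
  then show "(expectation (\<lambda>x. \<bar>Z x\<bar>))\<^sup>2 \<le> expectation (\<lambda>x. (Z x)\<^sup>2)"
    using variance_positive[of "\<lambda>x. \<bar>Z x\<bar>"] by (simp add: power2_abs)
qed

text \<open>Truncation at level K turns the L1 bound into a second-moment computation, in which the
  common mixed moment is annihilated because the weights sum to 0.\<close>

lemma expectation_abs_weighted_sum_le:
  fixes W :: "nat \<Rightarrow> 'a \<Rightarrow> real" and \<alpha> :: "nat \<Rightarrow> real"
  assumes W: "\<And>i. i < r \<Longrightarrow> integrable M (W i)" "\<And>i x. 0 \<le> W i x" and K: "0 \<le> K"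
    and trunc: "\<And>i. i < r \<Longrightarrow> expectation (\<lambda>x. W i x - min (W i x) K) \<le> \<delta>"
    and mixed: "\<And>i j. i < r \<Longrightarrow> j < r \<Longrightarrow> i \<noteq> j \<Longrightarrow> expectation (\<lambda>x. min (W i x) K * min (W j x) K) = c"
    and square: "\<And>i. i < r \<Longrightarrow> expectation (\<lambda>x. min (W i x) K * min (W i x) K) = d"
    and c: "0 \<le> c" and \<alpha>: "(\<Sum>i<r. \<alpha> i) = 0"
  shows "expectation (\<lambda>x. \<bar>\<Sum>i<r. \<alpha> i * W i x\<bar>) \<le> (\<Sum>i<r. \<bar>\<alpha> i\<bar>) * \<delta> + K * sqrt (\<Sum>i<r. (\<alpha> i)\<^sup>2)"
proof (cases "r = 0")
  case False
  define U where "U i x = min (W i x) K" for i x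
  have U: "0 \<le> U i x" "U i x \<le> K" "U i x \<le> W i x" for i x
    using W(2) K by (auto simp: U_def)
  have Umeas: "U i \<in> borel_measurable M" if "i < r" for i
    unfolding U_def using W(1)[OF that] by measurable
  have UUint: "integrable M (\<lambda>x. U i x * U j x)" if "i < r" "j < r" for i j
  proof (rule integrable_const_bound[of _ "K * K"])
    show "AE x in M. norm (U i x * U j x) \<le> K * K"
      using U K by (auto intro!: AE_I2 simp: abs_mult intro: mult_mono)
  qed (use Umeas that in measurable)
  have Uint: "integrable M (U i)" if "i < r" for i
    using U K Umeas[OF that] by (intro integrable_const_bound[of _ K]) auto
  have dle: "d \<le> K\<^sup>2"
  proof -
    have "expectation (\<lambda>x. U 0 x * U 0 x) \<le> expectation (\<lambda>x. K\<^sup>2)"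
      using False UUint U K by (intro integral_mono) (auto simp: power2_eq_square intro: mult_mono)
    then show ?thesis using square[of 0] False by (simp add: U_def prob_space)
  qed
  define Z where "Z x = (\<Sum>i<r. \<alpha> i * U i x)" for x
  have Z2: "(Z x)\<^sup>2 = (\<Sum>i<r. \<Sum>j<r. \<alpha> i * \<alpha> j * (U i x * U j x))" for x
    by (simp add: Z_def power2_eq_square sum_product mult_ac)
  have Zint: "integrable M Z" "integrable M (\<lambda>x. (Z x)\<^sup>2)"
    unfolding Z2 unfolding Z_def using Uint UUint
    by (auto intro!: Bochner_Integration.integrable_sum integrable_mult_right)
  have "expectation (\<lambda>x. (Z x)\<^sup>2) = (\<Sum>i<r. expectation (\<lambda>x. \<Sum>j<r. \<alpha> i * \<alpha> j * (U i x * U j x)))"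
    unfolding Z2 using UUint
    by (intro Bochner_Integration.integral_sum Bochner_Integration.integrable_sum integrable_mult_right) auto
  also have "\<dots> = (\<Sum>i<r. \<Sum>j<r. expectation (\<lambda>x. \<alpha> i * \<alpha> j * (U i x * U j x)))"
    using UUint by (intro sum.cong refl Bochner_Integration.integral_sum integrable_mult_right) auto
  also have "\<dots> = (\<Sum>i<r. \<Sum>j<r. \<alpha> i * \<alpha> j * expectation (\<lambda>x. U i x * U j x))"
    by simp
  \<comment> \<open>The matrix of second moments is \<open>c\<close> off the diagonal and
    \<open>d\<close> on it: the constant matrix \<open>c\<close> plus \<open>d - c\<close> on the
    diagonal.\<close>
  also have "\<dots> = (\<Sum>i<r. \<Sum>j<r. c * (\<alpha> i * \<alpha> j) + (if i = j then (d - c) * (\<alpha> i)\<^sup>2 else 0))"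
    using mixed square by (intro sum.cong refl) (auto simp: U_def power2_eq_square algebra_simps)
  also have "\<dots> = c * (\<Sum>i<r. \<Sum>j<r. \<alpha> i * \<alpha> j) + (d - c) * (\<Sum>i<r. (\<alpha> i)\<^sup>2)"
    by (simp add: sum.distrib sum_distrib_left)
  also have "(\<Sum>i<r. \<Sum>j<r. \<alpha> i * \<alpha> j) = (\<Sum>i<r. \<alpha> i) * (\<Sum>j<r. \<alpha> j)"
    by (rule sum_product[symmetric])
  also have "c * \<dots> + (d - c) * (\<Sum>i<r. (\<alpha> i)\<^sup>2) = (d - c) * (\<Sum>i<r. (\<alpha> i)\<^sup>2)"
    by (simp add: \<alpha>)
  \<comment> \<open>As \<open>c\<close> is nonnegative, \<open>d - c\<close> is at most
    \<open>d\<close>, which the truncation bounds by the square of \<open>K\<close>.\<close>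
  also have "\<dots> \<le> K\<^sup>2 * (\<Sum>i<r. (\<alpha> i)\<^sup>2)"
    using dle c by (intro mult_right_mono sum_nonneg) auto
  finally have "sqrt (expectation (\<lambda>x. (Z x)\<^sup>2)) \<le> sqrt (K\<^sup>2 * (\<Sum>i<r. (\<alpha> i)\<^sup>2))"
    by simp
  then have EZ: "expectation (\<lambda>x. \<bar>Z x\<bar>) \<le> K * sqrt (\<Sum>i<r. (\<alpha> i)\<^sup>2)"
    using expectation_abs_le_sqrt[OF Zint] K by (simp add: real_sqrt_mult)
  \<comment> \<open>The parts cut off by the truncation are nonnegative, so their expectations
    control them; only the truncated sum \<open>Z\<close> needs a second moment.\<close>
  have pw: "\<bar>\<Sum>i<r. \<alpha> i * W i x\<bar> \<le> (\<Sum>i<r. \<bar>\<alpha> i\<bar> * (W i x - U i x)) + \<bar>Z x\<bar>" for x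
  proof -
    have "(\<Sum>i<r. \<alpha> i * W i x) = (\<Sum>i<r. \<alpha> i * (W i x - U i x)) + Z x"
      by (simp add: Z_def sum.distrib[symmetric] algebra_simps)
    moreover have "\<bar>\<Sum>i<r. \<alpha> i * (W i x - U i x)\<bar> \<le> (\<Sum>i<r. \<bar>\<alpha> i\<bar> * (W i x - U i x))"
      using U(3) by (intro order_trans[OF sum_abs] sum_mono) (simp add: abs_mult)
    ultimately show ?thesis by linarith
  qed
  have "expectation (\<lambda>x. \<bar>\<Sum>i<r. \<alpha> i * W i x\<bar>)
      \<le> expectation (\<lambda>x. (\<Sum>i<r. \<bar>\<alpha> i\<bar> * (W i x - U i x)) + \<bar>Z x\<bar>)"
    using W(1) Uint Zint pw
    by (intro integral_mono Bochner_Integration.integrable_add integrable_abs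
        Bochner_Integration.integrable_sum integrable_mult_right Bochner_Integration.integrable_diff) auto
  also have "\<dots> = expectation (\<lambda>x. \<Sum>i<r. \<bar>\<alpha> i\<bar> * (W i x - U i x)) + expectation (\<lambda>x. \<bar>Z x\<bar>)"
    using W(1) Uint Zint
    by (intro Bochner_Integration.integral_add integrable_abs
        Bochner_Integration.integrable_sum integrable_mult_right Bochner_Integration.integrable_diff) auto
  also have "expectation (\<lambda>x. \<Sum>i<r. \<bar>\<alpha> i\<bar> * (W i x - U i x))
      = (\<Sum>i<r. expectation (\<lambda>x. \<bar>\<alpha> i\<bar> * (W i x - U i x)))"
    using W(1) Uint
    by (intro Bochner_Integration.integral_sum integrable_mult_right Bochner_Integration.integrable_diff) auto
  also have "\<dots> = (\<Sum>i<r. \<bar>\<alpha> i\<bar> * expectation (\<lambda>x. W i x - U i x))"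
    by simp
  also have "\<dots> + expectation (\<lambda>x. \<bar>Z x\<bar>) \<le> (\<Sum>i<r. \<bar>\<alpha> i\<bar> * \<delta>) + K * sqrt (\<Sum>i<r. (\<alpha> i)\<^sup>2)"
    using trunc by (intro add_mono sum_mono EZ mult_left_mono) (auto simp: U_def)
  finally show ?thesis by (simp add: sum_distrib_right)
qed simp

text \<open>The difference is a weighted sum with weights 1/p - 1/r for the first \<open>p\<close>
  terms and -1/r for the others. They sum to 0, their absolute values sum to 2 (1 - p/r), and their
  squares to 1/p - 1/r. Bounding these by 2 and 1/p removes \<open>r\<close> from the
  estimate.\<close>

lemma expectation_abs_diff_averages_le:
  fixes W :: "nat \<Rightarrow> 'a \<Rightarrow> real"
  assumes W: "\<And>i. i < r \<Longrightarrow> integrable M (W i)" "\<And>i x. 0 \<le> W i x" and K: "0 \<le> K"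
    and trunc: "\<And>i. i < r \<Longrightarrow> expectation (\<lambda>x. W i x - min (W i x) K) \<le> \<delta>" and "0 \<le> \<delta>"
    and mixed: "\<And>i j. i < r \<Longrightarrow> j < r \<Longrightarrow> i \<noteq> j \<Longrightarrow> expectation (\<lambda>x. min (W i x) K * min (W j x) K) = c"
    and square: "\<And>i. i < r \<Longrightarrow> expectation (\<lambda>x. min (W i x) K * min (W i x) K) = d"
    and c: "0 \<le> c" and p: "0 < p" "p \<le> r"
  shows "expectation (\<lambda>x. \<bar>(\<Sum>i<p. W i x) / p - (\<Sum>i<r. W i x) / r\<bar>) \<le> 2 * \<delta> + K / sqrt p"
proof -
  define \<alpha> :: "nat \<Rightarrow> real" where "\<alpha> i = (if i < p then 1 / p else 0) - 1 / r" for i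
  have ind: "(\<Sum>i<r. (if i < p then f i else 0)) = (\<Sum>i<p. f i)" for f :: "nat \<Rightarrow> real"
  proof -
    have "{..<r} \<inter> {i. i < p} = {..<p}" using p by auto
    then show ?thesis by (simp add: sum.inter_restrict[symmetric] sum.If_cases)
  qed
  have "(\<Sum>i<r. \<alpha> i) = (\<Sum>i<r. (if i < p then 1 / p else 0)) - (\<Sum>i<r. 1 / r)"
    by (simp add: \<alpha>_def sum_subtractf)
  then have sum0: "(\<Sum>i<r. \<alpha> i) = 0"
    unfolding ind using p by simp
  have "(\<Sum>i<r. \<bar>\<alpha> i\<bar>) \<le> (\<Sum>i<r. (if i < p then 1 / p else 0) + 1 / r)"
    by (intro sum_mono) (auto simp: \<alpha>_def intro: order_trans[OF abs_triangle_ineq4])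
  also have "\<dots> = 2" unfolding sum.distrib ind using p by simp
  finally have abs2: "(\<Sum>i<r. \<bar>\<alpha> i\<bar>) \<le> 2" .
  have "(\<Sum>i<r. (\<alpha> i)\<^sup>2) = (\<Sum>i<r. (if i < p then 1 / p * (1 / p) - 2 * (1 / p * (1 / r)) else 0) + (1 / r) * (1 / r))"
    by (intro sum.cong refl) (auto simp: \<alpha>_def power2_eq_square algebra_simps)
  also have "\<dots> = 1 / p - 1 / r"
    unfolding sum.distrib ind using p by (simp add: field_simps)
  also have "\<dots> \<le> 1 / p" by simp
  finally have sq: "sqrt (\<Sum>i<r. (\<alpha> i)\<^sup>2) \<le> 1 / sqrt p"
    by (metis real_sqrt_divide real_sqrt_le_mono real_sqrt_one)
  have "(\<Sum>i<r. \<alpha> i * W i x) = (\<Sum>i<p. W i x) / p - (\<Sum>i<r. W i x) / r" for x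
  proof -
    have "(\<Sum>i<r. \<alpha> i * W i x) = (\<Sum>i<r. (if i < p then W i x / p else 0) - W i x / r)"
      by (intro sum.cong refl) (auto simp: \<alpha>_def algebra_simps)
    then show ?thesis by (simp add: sum_subtractf ind sum_divide_distrib)
  qed
  then have "expectation (\<lambda>x. \<bar>(\<Sum>i<p. W i x) / p - (\<Sum>i<r. W i x) / r\<bar>)
     \<le> (\<Sum>i<r. \<bar>\<alpha> i\<bar>) * \<delta> + K * sqrt (\<Sum>i<r. (\<alpha> i)\<^sup>2)"
    using expectation_abs_weighted_sum_le[where W = W and \<alpha> = \<alpha>, OF W K trunc mixed square c sum0] by simp
  also have "\<dots> \<le> 2 * \<delta> + K * (1 / sqrt p)"
    using abs2 sq K \<open>0 \<le> \<delta>\<close> by (intro add_mono mult_right_mono mult_left_mono)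
  finally show ?thesis by simp
qed

section \<open>From a maximal inequality and the L1 Cauchy property to convergence\<close>

text \<open>The maximal inequality bounds the oscillation over a block by the L1 distance of its end
  points, which is small for late blocks; so almost every path is Cauchy. The offset
  \<open>n0\<close> leaves out an initial segment, where the sets may still have measure 0.\<close>

lemma converges_AE_L1_if_maximal_inequality:
  fixes Y :: "nat \<Rightarrow> 'a \<Rightarrow> real"
  assumes int: "\<And>n. integrable M (Y n)"
    and cauchy: "\<And>e. e > 0 \<Longrightarrow> \<exists>m. \<forall>n\<ge>m. \<forall>N\<ge>n. expectation (\<lambda>x. \<bar>Y n x - Y N x\<bar>) \<le> e"
    and maximal: "\<And>n N e. n0 \<le> n \<Longrightarrow> n \<le> N \<Longrightarrow> e > 0 \<Longrightarrow>
      e * prob {x\<in>space M. \<exists>k\<in>{n..N}. \<bar>Y k x - Y N x\<bar> > e} \<le> expectation (\<lambda>x. \<bar>Y n x - Y N x\<bar>)"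
  shows "\<exists>X. converges_AE_L1 M Y X"
proof -
  have [measurable]: "Y n \<in> borel_measurable M" for n using int by auto
  have osc: "AE x in M. \<exists>n. \<forall>k\<ge>n. \<forall>l\<ge>n. \<bar>Y k x - Y l x\<bar> \<le> 2 * e" if e: "e > 0" for e
  proof -
    \<comment> \<open>Oscillation inside the block from \<open>n\<close> to \<open>N\<close>. The
      threshold is twice that of the maximal inequality because both values are compared with the
      end value \<open>Y N\<close>.\<close>
    define R where "R n N = {x\<in>space M. \<exists>k\<in>{n..N}. \<exists>l\<in>{n..N}. \<bar>Y k x - Y l x\<bar> > 2 * e}" for n N
    have R[measurable]: "R n N \<in> events" for n N unfolding R_def by measurable
    have Rle: "e * prob (R n N) \<le> expectation (\<lambda>x. \<bar>Y n x - Y N x\<bar>)" if "n0 \<le> n" "n \<le> N" for n N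
    proof -
      have "R n N \<subseteq> {x\<in>space M. \<exists>k\<in>{n..N}. \<bar>Y k x - Y N x\<bar> > e}"
      proof
        fix x assume "x \<in> R n N"
        then obtain k l where "x \<in> space M" "k \<in> {n..N}" "l \<in> {n..N}" "\<bar>Y k x - Y l x\<bar> > 2 * e"
          by (auto simp: R_def)
        moreover from this have "\<bar>Y k x - Y N x\<bar> > e \<or> \<bar>Y l x - Y N x\<bar> > e" by linarith
        ultimately show "x \<in> {x\<in>space M. \<exists>k\<in>{n..N}. \<bar>Y k x - Y N x\<bar> > e}" by blast
      qed
      then have "prob (R n N) \<le> prob {x\<in>space M. \<exists>k\<in>{n..N}. \<bar>Y k x - Y N x\<bar> > e}"
        by (intro finite_measure_mono) measurable
      then show ?thesis using maximal[OF that e] e by (meson less_imp_le mult_left_mono order_trans)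
    qed
    \<comment> \<open>Off \<open>Q\<close> the oscillation is at most \<open>2 * e\<close> from some
      index on. The bound for a block starting at \<open>n\<close> is uniform in \<open>N\<close>,
      so it survives the increasing union over \<open>N\<close>, and it becomes arbitrarily small
      for large \<open>n\<close>.\<close>
    define Q where "Q = (\<Inter>n. \<Union>N. R n N)"
    have Qm[measurable]: "Q \<in> events" unfolding Q_def by measurable
    have small: "e * prob Q \<le> d" if d: "d > 0" for d
    proof -
      obtain m where m: "\<And>n N. n \<ge> m \<Longrightarrow> N \<ge> n \<Longrightarrow> expectation (\<lambda>x. \<bar>Y n x - Y N x\<bar>) \<le> d"
        using cauchy[OF d] by blast
      define n where "n = max m n0"
      have lim: "(\<lambda>N. prob (R n N)) \<longlonglongrightarrow> prob (\<Union>N. R n N)"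
        by (intro finite_Lim_measure_incseq incseq_SucI) (auto simp: R_def, fastforce)
      have "prob (\<Union>N. R n N) \<le> d / e"
      proof (rule LIMSEQ_le_const2[OF lim], intro exI allI impI)
        fix N assume "n \<le> N"
        then have "e * prob (R n N) \<le> d" using Rle[of n N] m[of n N] by (simp add: n_def)
        then show "prob (R n N) \<le> d / e" using e by (simp add: field_simps)
      qed
      moreover have "prob Q \<le> prob (\<Union>N. R n N)"
        by (intro finite_measure_mono) (auto simp: Q_def)
      ultimately have "prob Q \<le> d / e" by linarith
      then show ?thesis using e by (simp add: field_simps)
    qed
    have "e * prob Q \<le> 0" by (rule field_le_epsilon) (use small in simp)
    then have "prob Q = 0" using e by (simp add: mult_le_0_iff measure_le_0_iff)
    then have "AE x in M. x \<notin> Q" by (simp add: prob_eq_0 Qm)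
    with AE_space show ?thesis
    proof eventually_elim
      case (elim x)
      then obtain n where n: "\<And>N. x \<notin> R n N" by (auto simp: Q_def)
      have "\<bar>Y k x - Y l x\<bar> \<le> 2 * e" if "n \<le> k" "n \<le> l" for k l
        using n[of "max k l"] elim(1) that by (auto simp: R_def not_less max_def split: if_splits)
      then show ?case by blast
    qed
  qed
  have "AE x in M. \<forall>j. \<exists>n. \<forall>k\<ge>n. \<forall>l\<ge>n. \<bar>Y k x - Y l x\<bar> \<le> 2 * inverse (real (Suc j))"
    unfolding AE_all_countable using osc by simp
  then have conv: "AE x in M. (\<lambda>n. Y n x) \<longlonglongrightarrow> lim (\<lambda>n. Y n x)"
  proof eventually_elim
    case (elim x)
    have "Cauchy (\<lambda>n. Y n x)"
    proof (rule metric_CauchyI)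
      fix e :: real assume "e > 0"
      then obtain j where j: "inverse (real (Suc j)) < e / 2" using reals_Archimedean[of "e / 2"] by auto
      obtain n where n: "\<And>k l. k \<ge> n \<Longrightarrow> l \<ge> n \<Longrightarrow> \<bar>Y k x - Y l x\<bar> \<le> 2 * inverse (real (Suc j))"
        using elim by blast
      have "dist (Y k x) (Y l x) < e" if "k \<ge> n" "l \<ge> n" for k l
        using n[OF that] j by (simp add: dist_real_def)
      then show "\<exists>n. \<forall>k\<ge>n. \<forall>l\<ge>n. dist (Y k x) (Y l x) < e" by blast
    qed
    then show ?case using Cauchy_convergent_iff convergent_LIMSEQ_iff by blast
  qed
  define X where "X x = lim (\<lambda>n. Y n x)" for x
  have [measurable]: "X \<in> borel_measurable M" unfolding X_def by measurable
  \<comment> \<open>Stated with nonnegative integrals because \<open>X\<close> is not yet known to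
    be integrable. A bound on the distances to all later members passes to the limit by Fatou's
    lemma.\<close>
  have fatou: "(\<integral>\<^sup>+x. ennreal \<bar>Y n x - X x\<bar> \<partial>M) \<le> ennreal e"
    if "\<And>N. N \<ge> n \<Longrightarrow> expectation (\<lambda>x. \<bar>Y n x - Y N x\<bar>) \<le> e" for n e
  proof -
    have "(\<integral>\<^sup>+x. ennreal \<bar>Y n x - X x\<bar> \<partial>M) = (\<integral>\<^sup>+x. liminf (\<lambda>N. ennreal \<bar>Y n x - Y N x\<bar>) \<partial>M)"
    proof (rule nn_integral_cong_AE, use conv in eventually_elim)
      case (elim x)
      then have "(\<lambda>N. ennreal \<bar>Y n x - Y N x\<bar>) \<longlonglongrightarrow> ennreal \<bar>Y n x - X x\<bar>"
        unfolding X_def by (intro tendsto_intros)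
      then show ?case by (intro lim_imp_Liminf[symmetric]) simp_all
    qed
    also have "\<dots> \<le> liminf (\<lambda>N. \<integral>\<^sup>+x. ennreal \<bar>Y n x - Y N x\<bar> \<partial>M)"
      by (rule nn_integral_liminf) measurable
    also have "\<dots> \<le> limsup (\<lambda>N. \<integral>\<^sup>+x. ennreal \<bar>Y n x - Y N x\<bar> \<partial>M)"
      by (rule Liminf_le_Limsup) simp
    also have "\<dots> \<le> ennreal e"
    proof (rule Limsup_bounded, rule eventually_sequentiallyI[of n])
      fix N assume "n \<le> N"
      have "(\<integral>\<^sup>+x. ennreal \<bar>Y n x - Y N x\<bar> \<partial>M) = ennreal (expectation (\<lambda>x. \<bar>Y n x - Y N x\<bar>))"
        using int by (intro nn_integral_eq_integral) auto
      then show "(\<integral>\<^sup>+x. ennreal \<bar>Y n x - Y N x\<bar> \<partial>M) \<le> ennreal e"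
        using that[OF \<open>n \<le> N\<close>] by (simp add: ennreal_leI)
    qed
    finally show ?thesis .
  qed
  \<comment> \<open>\<open>X\<close> is integrable because it lies at finite L1 distance from one
    integrable \<open>Y m\<close>.\<close>
  obtain m where "\<And>N. N \<ge> m \<Longrightarrow> expectation (\<lambda>x. \<bar>Y m x - Y N x\<bar>) \<le> 1"
    using cauchy[of 1] by auto
  from fatou[OF this] have "integrable M (\<lambda>x. Y m x - X x)"
    by (intro integrableI_bounded) (auto intro: le_less_trans)
  from Bochner_Integration.integrable_diff[OF int[of m] this] have Xint: "integrable M X" by simp
  have "(\<lambda>n. expectation (\<lambda>x. \<bar>Y n x - X x\<bar>)) \<longlonglongrightarrow> 0"
  proof (rule tendstoI)
    fix e :: real assume "e > 0"
    then obtain m where m: "\<And>n N. n \<ge> m \<Longrightarrow> N \<ge> n \<Longrightarrow> expectation (\<lambda>x. \<bar>Y n x - Y N x\<bar>) \<le> e / 2"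
      using cauchy[of "e / 2"] by auto
    have "expectation (\<lambda>x. \<bar>Y n x - X x\<bar>) < e" if "n \<ge> m" for n
    proof -
      have "ennreal (expectation (\<lambda>x. \<bar>Y n x - X x\<bar>)) \<le> ennreal (e / 2)"
        using fatou[of n "e / 2"] m[OF that] int Xint
        by (subst nn_integral_eq_integral[symmetric]) auto
      then show ?thesis using \<open>e > 0\<close> by (simp add: ennreal_le_iff)
    qed
    then show "\<forall>\<^sub>F n in sequentially. dist (expectation (\<lambda>x. \<bar>Y n x - X x\<bar>)) 0 < e"
      by (intro eventually_sequentiallyI[of m]) (simp add: dist_real_def)
  qed
  with conv Xint int have "converges_AE_L1 M Y X"
    by (simp add: converges_AE_L1_def X_def)
  then show ?thesis by (rule exI[of _ X])
qed

end

section \<open>Exchangeable random measures\<close>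

locale exchangeable_random_measure = prob_space P
  for P :: "'w measure" and M :: "'a measure" and \<xi> :: "'w \<Rightarrow> 'a measure" +
  assumes atl: "atomless M" and rm: "random_measure P M \<xi>" and exch: "exchangeable P M \<xi>"
begin

section \<open>Transfer of laws and expectations between families of sets with equal
  measures\<close>

lemma sets_xi: "\<omega> \<in> space P \<Longrightarrow> sets (\<xi> \<omega>) = sets M"
  using rm by (simp add: random_measure_def)

lemma emeasure_xi_measurable [measurable]:
  "A \<in> sets M \<Longrightarrow> (\<lambda>\<omega>. emeasure (\<xi> \<omega>) A) \<in> borel_measurable P"
  using rm by (simp add: random_measure_def)

lemma measure_xi_measurable [measurable]:
  "A \<in> sets M \<Longrightarrow> (\<lambda>\<omega>. measure (\<xi> \<omega>) A) \<in> borel_measurable P"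
  unfolding measure_def by measurable

lemma average_measurable [measurable]: "A \<in> sets M \<Longrightarrow> average M \<xi> A \<in> borel_measurable P"
  unfolding average_def by (intro borel_measurable_divide measure_xi_measurable borel_measurable_const)

lemma joint_law_eq:
  assumes "1 \<le> n" and A: "\<And>i. i < n \<Longrightarrow> A i \<in> fmeasurable M" "disjoint_family_on A {..<n}"
    and B: "\<And>i. i < n \<Longrightarrow> B i \<in> fmeasurable M" "disjoint_family_on B {..<n}"
    and eq: "\<And>i. i < n \<Longrightarrow> measure M (A i) = measure M (B i)"
  shows "joint_law P \<xi> n A = joint_law P \<xi> n B"
proof -
  have "emeasure M (A i) = emeasure M (B i)" if "i < n" for i
    using eq[OF that] emeasure_eq_measure2[OF A(1)[OF that]] emeasure_eq_measure2[OF B(1)[OF that]] by simp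
  moreover have "\<forall>i<n. A i \<in> sets M" "\<forall>i<n. B i \<in> sets M"
    using A(1) B(1) by (simp_all add: fmeasurableD)
  ultimately show ?thesis
    using exch \<open>1 \<le> n\<close> A(2) B(2) unfolding exchangeable_def by blast
qed

text \<open>The values stay in [0,\<infinity>] here, since this is what transfers finiteness of the
  expectation before \<xi>(A) is known to be almost surely finite.\<close>

lemma law_eq:
  assumes "A \<in> fmeasurable M" "B \<in> fmeasurable M" "measure M A = measure M B"
  shows "distr P borel (\<lambda>\<omega>. emeasure (\<xi> \<omega>) A) = distr P borel (\<lambda>\<omega>. emeasure (\<xi> \<omega>) B)"
proof -
  have "distr (joint_law P \<xi> 1 (\<lambda>_. E)) borel (\<lambda>x. x 0) = distr P borel (\<lambda>\<omega>. emeasure (\<xi> \<omega>) E)"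
    if "E \<in> fmeasurable M" for E
    unfolding joint_law_def using that
    by (subst distr_distr) (auto simp: comp_def intro!: measurable_restrict)
  moreover have "joint_law P \<xi> 1 (\<lambda>_. A) = joint_law P \<xi> 1 (\<lambda>_. B)"
    using assms by (intro joint_law_eq) (auto simp: disjoint_family_on_def)
  ultimately show ?thesis using assms by metis
qed

text \<open>\<open>enn2real\<close> is measurable, so both sides are integrals of one function
  against one joint law. If that function is not integrable, both sides take the default value
  0.\<close>

lemma expectation_eq_if_measures_eq:
  fixes \<Phi> :: "(nat \<Rightarrow> real) \<Rightarrow> real"
  assumes "1 \<le> n" and A: "\<And>i. i < n \<Longrightarrow> A i \<in> fmeasurable M" "disjoint_family_on A {..<n}"
    and B: "\<And>i. i < n \<Longrightarrow> B i \<in> fmeasurable M" "disjoint_family_on B {..<n}"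
    and eq: "\<And>i. i < n \<Longrightarrow> measure M (A i) = measure M (B i)"
    and [measurable]: "\<Phi> \<in> borel_measurable (\<Pi>\<^sub>M i\<in>{..<n}. borel)"
  shows "expectation (\<lambda>\<omega>. \<Phi> (\<lambda>i\<in>{..<n}. measure (\<xi> \<omega>) (A i))) =
    expectation (\<lambda>\<omega>. \<Phi> (\<lambda>i\<in>{..<n}. measure (\<xi> \<omega>) (B i)))"
proof -
  define \<Psi> where "\<Psi> x = \<Phi> (\<lambda>i\<in>{..<n}. enn2real (x i))" for x :: "nat \<Rightarrow> ennreal"
  have [measurable]: "\<Psi> \<in> borel_measurable (\<Pi>\<^sub>M i\<in>{..<n}. borel)"
    unfolding \<Psi>_def by measurable
  have law: "integral\<^sup>L (joint_law P \<xi> n E) \<Psi> = expectation (\<lambda>\<omega>. \<Phi> (\<lambda>i\<in>{..<n}. measure (\<xi> \<omega>) (E i)))"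
    if "\<And>i. i < n \<Longrightarrow> E i \<in> fmeasurable M" for E
  proof -
    have "(\<lambda>\<omega>. \<lambda>i\<in>{..<n}. emeasure (\<xi> \<omega>) (E i)) \<in> measurable P (\<Pi>\<^sub>M i\<in>{..<n}. borel)"
      using that by (intro measurable_restrict emeasure_xi_measurable) (auto dest: fmeasurableD)
    then have "integral\<^sup>L (joint_law P \<xi> n E) \<Psi> = expectation (\<lambda>\<omega>. \<Psi> (\<lambda>i\<in>{..<n}. emeasure (\<xi> \<omega>) (E i)))"
      unfolding joint_law_def by (rule integral_distr) measurable
    also have "\<dots> = expectation (\<lambda>\<omega>. \<Phi> (\<lambda>i\<in>{..<n}. measure (\<xi> \<omega>) (E i)))"
      by (simp add: \<Psi>_def measure_def cong: restrict_cong)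
    finally show ?thesis .
  qed
  have "joint_law P \<xi> n A = joint_law P \<xi> n B"
    using assms(1-6) by (rule joint_law_eq)
  with law[of A] law[of B] A(1) B(1) show ?thesis by simp
qed

lemma expectation_measure_eq:
  fixes f :: "real \<Rightarrow> real"
  assumes "A \<in> fmeasurable M" "B \<in> fmeasurable M" "measure M A = measure M B"
    and [measurable]: "f \<in> borel_measurable borel"
  shows "expectation (\<lambda>\<omega>. f (measure (\<xi> \<omega>) A)) = expectation (\<lambda>\<omega>. f (measure (\<xi> \<omega>) B))"
  using expectation_eq_if_measures_eq[of 1 "\<lambda>_. A" "\<lambda>_. B" "\<lambda>x. f (x 0)"] assms
  by (simp add: disjoint_family_on_def)

lemma expectation_mult_measure_eq:
  fixes f :: "real \<Rightarrow> real"
  assumes A: "A \<in> fmeasurable M" "A' \<in> fmeasurable M" "A \<inter> A' = {}"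
    and B: "B \<in> fmeasurable M" "B' \<in> fmeasurable M" "B \<inter> B' = {}"
    and "measure M A = measure M B" "measure M A' = measure M B'"
    and [measurable]: "f \<in> borel_measurable borel"
  shows "expectation (\<lambda>\<omega>. f (measure (\<xi> \<omega>) A) * f (measure (\<xi> \<omega>) A')) =
    expectation (\<lambda>\<omega>. f (measure (\<xi> \<omega>) B) * f (measure (\<xi> \<omega>) B'))"
proof -
  let ?c = "\<lambda>E E' i. if i = (0::nat) then E else E'"
  have "disjoint_family_on (?c E E') {..<2}" if "E \<inter> E' = {}" for E E' :: "'a set"
    using that by (auto simp: disjoint_family_on_def)
  moreover have "(\<lambda>x. f (x 0) * f (x 1)) \<in> borel_measurable (\<Pi>\<^sub>M i\<in>{..<2::nat}. borel)"
    by measurable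
  ultimately show ?thesis
    using expectation_eq_if_measures_eq[of 2 "?c A A'" "?c B B'" "\<lambda>x. f (x 0) * f (x 1)"] assms
    by simp
qed

end

text \<open>The reference set \<open>U\<close> plays two roles: its finite expectation is passed on
  to every set of finite measure, and its measure is the unit into which sets are cut for the
  rate.\<close>

locale integrable_exchangeable_random_measure = exchangeable_random_measure P M \<xi>
  for P :: "'w measure" and M :: "'a measure" and \<xi> :: "'w \<Rightarrow> 'a measure" +
  fixes U :: "'a set"
  assumes U: "U \<in> fmeasurable M" and U_pos: "0 < measure M U"
    and U_integrable: "(\<integral>\<^sup>+\<omega>. emeasure (\<xi> \<omega>) U \<partial>P) < \<infinity>"
begin

section \<open>Integrability spreads from \<open>U\<close> to all sets of finite measure\<close>

text \<open>Cut \<open>A\<close> into finitely many equal pieces, each no larger in measure than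
  \<open>U\<close>. Each piece then has the same law under \<xi> as some subset of \<open>U\<close>
  and inherits the bound by the expectation on \<open>U\<close>.\<close>

lemma nn_integral_emeasure_finite:
  assumes A: "A \<in> fmeasurable M"
  shows "(\<integral>\<^sup>+\<omega>. emeasure (\<xi> \<omega>) A \<partial>P) < \<infinity>"
proof -
  obtain n :: nat where n: "measure M A < real n * measure M U"
    using reals_Archimedean3[OF U_pos] by blast
  have "real n \<noteq> 0" using n measure_nonneg[of M A] by (metis linorder_not_less mult_zero_left)
  then have n1: "1 \<le> n" by simp
  define u where "u = measure M A / n"
  have u: "0 \<le> u" "u \<le> measure M U" "measure M A = real n * u"
    using n n1 by (simp_all add: u_def field_simps)
  obtain E where E: "E \<in> sets M" "E \<subseteq> U" "measure M E = u"
    using atomless_subset_of_measure[OF atl U u(1,2)] by blast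
  have Ef: "E \<in> fmeasurable M" using U E by (metis fmeasurableI2)
  obtain V where V: "\<forall>i<n. V i \<in> fmeasurable M \<and> measure M (V i) = u"
      "disjoint_family_on V {..<n}" "(\<Union>i<n. V i) = A"
    using atomless_partition[OF atl n1 A u(3,1)] by blast
  have piece: "(\<integral>\<^sup>+\<omega>. emeasure (\<xi> \<omega>) (V i) \<partial>P) < \<infinity>" if "i < n" for i
  proof -
    have Vi: "V i \<in> fmeasurable M" "measure M (V i) = measure M E" using V(1) that E by auto
    have id: "(\<integral>\<^sup>+\<omega>. emeasure (\<xi> \<omega>) F \<partial>P) = (\<integral>\<^sup>+x. x \<partial>distr P borel (\<lambda>\<omega>. emeasure (\<xi> \<omega>) F))"
      if "F \<in> fmeasurable M" for F
      using fmeasurableD[OF that] by (subst nn_integral_distr) auto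
    have "(\<integral>\<^sup>+\<omega>. emeasure (\<xi> \<omega>) (V i) \<partial>P) = (\<integral>\<^sup>+\<omega>. emeasure (\<xi> \<omega>) E \<partial>P)"
      unfolding id[OF Vi(1)] id[OF Ef] law_eq[OF Vi(1) Ef Vi(2)] ..
    also have "\<dots> \<le> (\<integral>\<^sup>+\<omega>. emeasure (\<xi> \<omega>) U \<partial>P)"
      using E(2) fmeasurableD[OF U] by (intro nn_integral_mono emeasure_mono) (auto simp: sets_xi)
    finally show ?thesis using U_integrable by (rule le_less_trans)
  qed
  have Vs: "V i \<in> sets M" if "i < n" for i using V(1) that by (auto dest: fmeasurableD)
  have "(\<integral>\<^sup>+\<omega>. emeasure (\<xi> \<omega>) A \<partial>P) = (\<integral>\<^sup>+\<omega>. (\<Sum>i<n. emeasure (\<xi> \<omega>) (V i)) \<partial>P)"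
    unfolding V(3)[symmetric] using V(2) Vs
    by (intro nn_integral_cong sum_emeasure[symmetric]) (auto simp: sets_xi)
  also have "\<dots> = (\<Sum>i<n. \<integral>\<^sup>+\<omega>. emeasure (\<xi> \<omega>) (V i) \<partial>P)"
    using Vs by (intro nn_integral_sum) auto
  also have "\<dots> < \<infinity>" using piece by (simp add: less_top)
  finally show ?thesis .
qed

lemma AE_fmeasurable:
  assumes A: "A \<in> fmeasurable M"
  shows "AE \<omega> in P. A \<in> fmeasurable (\<xi> \<omega>)"
proof -
  have "AE \<omega> in P. emeasure (\<xi> \<omega>) A \<noteq> \<infinity>"
    using nn_integral_emeasure_finite[OF A] fmeasurableD[OF A]
    by (intro nn_integral_PInf_AE) auto
  with AE_space show ?thesis
    by eventually_elim (auto simp: fmeasurable_def sets_xi less_top intro: fmeasurableD[OF A])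
qed

lemma integrable_measure:
  assumes A: "A \<in> fmeasurable M"
  shows "integrable P (\<lambda>\<omega>. measure (\<xi> \<omega>) A)"
proof (rule integrableI_bounded)
  have "(\<integral>\<^sup>+\<omega>. ennreal (norm (measure (\<xi> \<omega>) A)) \<partial>P) \<le> (\<integral>\<^sup>+\<omega>. emeasure (\<xi> \<omega>) A \<partial>P)"
    by (intro nn_integral_mono) (auto simp: measure_def ennreal_enn2real_if)
  also have "\<dots> < \<infinity>" by (rule nn_integral_emeasure_finite[OF A])
  finally show "(\<integral>\<^sup>+\<omega>. ennreal (norm (measure (\<xi> \<omega>) A)) \<partial>P) < \<infinity>" .
qed (use fmeasurableD[OF A] in measurable)

lemma integrable_average: "A \<in> fmeasurable M \<Longrightarrow> integrable P (average M \<xi> A)"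
  unfolding average_def by (intro integrable_divide integrable_measure)

subsection \<open>Reversed martingale property\<close>

text \<open>Boundedness of \<open>H\<close> gives integrability, and nonnegativity makes the set
  function monotone, on which the proportionality argument rests. Signed test functions are reduced
  to this case afterwards.\<close>

lemma expectation_mult_proportional_nonneg:
  fixes H :: "(nat \<Rightarrow> real) \<Rightarrow> real"
  assumes C: "\<And>i. i \<le> k \<Longrightarrow> C i \<in> fmeasurable M" "\<And>i j. i \<le> j \<Longrightarrow> j \<le> k \<Longrightarrow> C i \<subseteq> C j"
    and H[measurable]: "H \<in> borel_measurable (\<Pi>\<^sub>M i\<in>{..k}. borel)"
    and Hb: "\<And>x. 0 \<le> H x" "\<And>x. H x \<le> K"
    and A: "A \<in> sets M" "A \<subseteq> C 0"
  shows "measure M (C 0) * expectation (\<lambda>\<omega>. H (\<lambda>i\<in>{..k}. measure (\<xi> \<omega>) (C i)) * measure (\<xi> \<omega>) A) =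
    measure M A * expectation (\<lambda>\<omega>. H (\<lambda>i\<in>{..k}. measure (\<xi> \<omega>) (C i)) * measure (\<xi> \<omega>) (C 0))"
proof -
  define h where "h \<omega> = H (\<lambda>i\<in>{..k}. measure (\<xi> \<omega>) (C i))" for \<omega>
  have hm[measurable]: "h \<in> borel_measurable P"
  proof -
    have "(\<lambda>\<omega>. \<lambda>i\<in>{..k}. measure (\<xi> \<omega>) (C i)) \<in> measurable P (\<Pi>\<^sub>M i\<in>{..k}. borel)"
      using C(1) by (intro measurable_restrict measure_xi_measurable) (auto dest: fmeasurableD)
    then show ?thesis unfolding h_def by (rule measurable_compose) (rule H)
  qed
  have fm: "E \<in> fmeasurable M" if "E \<in> sets M" "E \<subseteq> C 0" for E
    using that C(1)[of 0] by (metis fmeasurableI2 zero_le)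
  have int: "integrable P (\<lambda>\<omega>. h \<omega> * measure (\<xi> \<omega>) E)" if "E \<in> sets M" "E \<subseteq> C 0" for E
    using Hb by (intro integrable_bounded_mult[where K = K] hm integrable_measure fm that) (simp add: h_def)
  define G where "G E = expectation (\<lambda>\<omega>. h \<omega> * measure (\<xi> \<omega>) E)" for E
  have "measure M (C 0) * G A = measure M A * G (C 0)"
  proof (rule additive_invariant_imp_proportional[OF atl _ A])
    show "C 0 \<in> fmeasurable M" using C(1) by simp
    show "0 \<le> G E" for E
      unfolding G_def using Hb(1) by (intro integral_nonneg_AE) (simp add: h_def)
    show "G (E \<union> F) = G E + G F"
      if E: "E \<in> sets M" "F \<in> sets M" "E \<subseteq> C 0" "F \<subseteq> C 0" "E \<inter> F = {}" for E F
    proof -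
      have "G (E \<union> F) = expectation (\<lambda>\<omega>. h \<omega> * measure (\<xi> \<omega>) E + h \<omega> * measure (\<xi> \<omega>) F)"
        unfolding G_def
      proof (rule integral_cong_AE)
        show "AE \<omega> in P. h \<omega> * measure (\<xi> \<omega>) (E \<union> F) = h \<omega> * measure (\<xi> \<omega>) E + h \<omega> * measure (\<xi> \<omega>) F"
          using AE_fmeasurable[OF fm[OF E(1,3)]] AE_fmeasurable[OF fm[OF E(2,4)]]
        proof eventually_elim
          case (elim \<omega>)
          then have "measure (\<xi> \<omega>) (E \<union> F) = measure (\<xi> \<omega>) E + measure (\<xi> \<omega>) F"
            using E(5) by (intro measure_Union) (auto simp: fmeasurable_def)
          then show ?case by (simp add: algebra_simps)
        qed
      qed (use E in measurable)
      also have "\<dots> = G E + G F"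
        unfolding G_def using int E by (intro Bochner_Integration.integral_add) auto
      finally show ?thesis .
    qed
    show "G E = G E'"
      if E: "E \<in> sets M" "E' \<in> sets M" "E \<subseteq> C 0" "E' \<subseteq> C 0" "measure M E = measure M E'" for E E'
    proof -
      \<comment> \<open>The increments of the chain, with its smallest set split into B and the rest: the values
        of the random measure on the chain are partial sums of those on the increments, so
        exchangeability applies to increments.\<close>
      define F where "F B i = (case i of 0 \<Rightarrow> B | Suc 0 \<Rightarrow> C 0 - B | Suc (Suc j) \<Rightarrow> C (Suc j) - C j)" for B i
      have F_simps: "F B 0 = B" "F B (Suc 0) = C 0 - B" "F B (Suc (Suc j)) = C (Suc j) - C j" for B j
        by (simp_all add: F_def)
      \<comment> \<open>Position 0 carries the value on \<open>B\<close>. The chain value at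
        \<open>i\<close> is the partial sum up to \<open>Suc i\<close>, one position further,
        because \<open>C 0\<close> occupies the two positions 0 and 1.\<close>
      define \<Phi> where "\<Phi> x = H (\<lambda>i\<in>{..k}. \<Sum>j\<le>Suc i. x j) * x 0" for x :: "nat \<Rightarrow> real"
      have \<Phi>m: "\<Phi> \<in> borel_measurable (\<Pi>\<^sub>M i\<in>{..<k+2}. borel)"
      proof -
        have "(\<lambda>x::nat \<Rightarrow> real. \<lambda>i\<in>{..k}. \<Sum>j\<le>Suc i. x j) \<in> measurable (\<Pi>\<^sub>M i\<in>{..<k+2}. borel) (\<Pi>\<^sub>M i\<in>{..k}. borel)"
        proof (rule measurable_restrict)
          fix i assume "i \<in> {..k}"
          then have "(\<lambda>x. x j) \<in> borel_measurable (\<Pi>\<^sub>M i\<in>{..<k+2}. borel :: real measure)" if "j \<in> {..Suc i}" for j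
            using that by (intro measurable_component_singleton) auto
          then show "(\<lambda>x. \<Sum>j\<le>Suc i. x j) \<in> borel_measurable (\<Pi>\<^sub>M i\<in>{..<k+2}. borel :: real measure)"
            by (rule borel_measurable_sum)
        qed
        then have "(\<lambda>x. H (\<lambda>i\<in>{..k}. \<Sum>j\<le>Suc i. x j)) \<in> borel_measurable (\<Pi>\<^sub>M i\<in>{..<k+2}. borel)"
          by (rule measurable_compose) (rule H)
        moreover have "(\<lambda>x. x 0) \<in> borel_measurable (\<Pi>\<^sub>M i\<in>{..<k+2}. borel :: real measure)"
          by (intro measurable_component_singleton) simp
        ultimately show ?thesis unfolding \<Phi>_def by (rule borel_measurable_times)
      qed
      have Ffm: "F B i \<in> fmeasurable M" if "B \<in> sets M" "B \<subseteq> C 0" "i < k + 2" for B i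
        using that fm[OF that(1,2)] C(1)
        by (cases i; cases "i - 1") (auto simp: F_simps intro!: fmeasurable.Diff)
      \<comment> \<open>For \<open>j\<close> at least 2, the increment at position
        \<open>j = Suc (Suc m)\<close> lies outside \<open>C m\<close>, while all earlier positions
        lie inside it.\<close>
      have Fsub: "F B i \<inter> F B j = {}" if "B \<subseteq> C 0" "i < j" "j < k + 2" for B i j
      proof (cases "j = 1")
        case True
        then show ?thesis using that by (auto simp: F_simps)
      next
        case False
        then obtain m where m: "j = Suc (Suc m)" using \<open>i < j\<close> by (metis One_nat_def not_less0 old.nat.exhaust)
        have "F B i \<subseteq> C m"
        proof (cases "i < 2")
          case True
          then have "F B i \<subseteq> C 0" using that(1) by (auto simp: less_2_cases_iff F_simps)
          then show ?thesis using C(2)[of 0 m] m that(3) by auto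
        next
          case False
          then obtain l where l: "i = Suc (Suc l)" by (metis add_2_eq_Suc not_less le_Suc_ex)
          then have "C (Suc l) \<subseteq> C m" using C(2)[of "Suc l" m] m that by simp
          then show ?thesis by (auto simp: l F_simps)
        qed
        then show ?thesis by (auto simp: m F_simps)
      qed
      have Fdis: "disjoint_family_on (F B) {..<k+2}" if "B \<subseteq> C 0" for B
        unfolding disjoint_family_on_def using Fsub[OF that] by (metis Int_commute lessThan_iff linorder_neqE_nat)
      have Gval: "G B = expectation (\<lambda>\<omega>. \<Phi> (\<lambda>i\<in>{..<k+2}. measure (\<xi> \<omega>) (F B i)))"
        if B: "B \<in> sets M" "B \<subseteq> C 0" for B
        unfolding G_def
      proof (rule integral_cong_AE)
        have "(\<lambda>\<omega>. \<lambda>i\<in>{..<k+2}. measure (\<xi> \<omega>) (F B i)) \<in> measurable P (\<Pi>\<^sub>M i\<in>{..<k+2}. borel)"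
          using Ffm[OF B] by (intro measurable_restrict measure_xi_measurable) (auto dest: fmeasurableD)
        then show "(\<lambda>\<omega>. \<Phi> (\<lambda>i\<in>{..<k+2}. measure (\<xi> \<omega>) (F B i))) \<in> borel_measurable P"
          by (rule measurable_compose) (rule \<Phi>m)
        \<comment> \<open>Real-valued measures telescope only where they are finite; almost sure
          finiteness on the largest set \<open>C k\<close> covers the whole chain.\<close>
        show "AE \<omega> in P. h \<omega> * measure (\<xi> \<omega>) B = \<Phi> (\<lambda>i\<in>{..<k+2}. measure (\<xi> \<omega>) (F B i))"
          using AE_space AE_fmeasurable[OF C(1)[OF order_refl]]
        proof eventually_elim
          case (elim \<omega>)
          have Cx: "C i \<in> fmeasurable (\<xi> \<omega>)" if "i \<le> k" for i
            using C(2)[OF that order_refl] fmeasurableD[OF C(1)[OF that]] sets_xi[OF elim(1)]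
            by (intro fmeasurableI2[OF elim(2)]) simp_all
          have Bx: "B \<in> sets (\<xi> \<omega>)" using B sets_xi[OF elim(1)] by simp
          have tele: "(\<Sum>j\<le>Suc i. measure (\<xi> \<omega>) (F B j)) = measure (\<xi> \<omega>) (C i)" if "i \<le> k" for i
            using that
          proof (induction i)
            case 0
            show ?case
              using measurable_measure_Diff[OF Cx[of 0] Bx B(2)] by (simp add: F_simps)
          next
            case (Suc i)
            then have "measure (\<xi> \<omega>) (C (Suc i) - C i) = measure (\<xi> \<omega>) (C (Suc i)) - measure (\<xi> \<omega>) (C i)"
              using Cx by (intro measurable_measure_Diff C(2)) (simp_all add: fmeasurableD)
            with Suc show ?case by (simp add: F_simps)
          qed
          have "(\<lambda>i\<in>{..k}. \<Sum>j\<le>Suc i. (\<lambda>i\<in>{..<k+2}. measure (\<xi> \<omega>) (F B i)) j) = (\<lambda>i\<in>{..k}. measure (\<xi> \<omega>) (C i))"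
          proof (rule restrict_ext)
            fix i assume "i \<in> {..k}"
            then have "(\<Sum>j\<le>Suc i. (\<lambda>i\<in>{..<k+2}. measure (\<xi> \<omega>) (F B i)) j) = (\<Sum>j\<le>Suc i. measure (\<xi> \<omega>) (F B j))"
              by (intro sum.cong refl) auto
            then show "(\<Sum>j\<le>Suc i. (\<lambda>i\<in>{..<k+2}. measure (\<xi> \<omega>) (F B i)) j) = measure (\<xi> \<omega>) (C i)"
              using tele[of i] \<open>i \<in> {..k}\<close> by simp
          qed
          then show ?case by (simp add: \<Phi>_def h_def F_simps del: sum.atMost_Suc)
        qed
      qed (use B in measurable)
      have "measure M (F E i) = measure M (F E' i)" if "i < k + 2" for i
      proof -
        consider "i = 0" | "i = 1" | j where "i = Suc (Suc j)"
          by (metis One_nat_def not0_implies_Suc)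
        then show ?thesis
        proof cases
          case 2
          then show ?thesis
            using measurable_measure_Diff[OF C(1)[of 0] E(1,3)] measurable_measure_Diff[OF C(1)[of 0] E(2,4)] E(5)
            by (simp add: F_simps)
        qed (simp_all add: F_simps E(5))
      qed
      then have "expectation (\<lambda>\<omega>. \<Phi> (\<lambda>i\<in>{..<k+2}. measure (\<xi> \<omega>) (F E i)))
          = expectation (\<lambda>\<omega>. \<Phi> (\<lambda>i\<in>{..<k+2}. measure (\<xi> \<omega>) (F E' i)))"
        using E Ffm Fdis \<Phi>m by (intro expectation_eq_if_measures_eq) auto
      then show ?thesis using Gval E by simp
    qed
  qed
  then show ?thesis unfolding G_def h_def .
qed

text \<open>The reversed martingale property of the averages, tested against a bounded function of
  the values on a finite chain of larger sets.\<close>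

lemma expectation_mult_average_eq:
  fixes H :: "(nat \<Rightarrow> real) \<Rightarrow> real"
  assumes C: "\<And>i. i \<le> k \<Longrightarrow> C i \<in> fmeasurable M" "\<And>i j. i \<le> j \<Longrightarrow> j \<le> k \<Longrightarrow> C i \<subseteq> C j"
    and H[measurable]: "H \<in> borel_measurable (\<Pi>\<^sub>M i\<in>{..k}. borel)"
    and Hb: "\<And>x. \<bar>H x\<bar> \<le> K"
    and A: "A \<in> sets M" "A \<subseteq> C 0" "0 < measure M A"
  shows "(\<lambda>\<omega>. H (\<lambda>i\<in>{..k}. measure (\<xi> \<omega>) (C i))) \<in> borel_measurable P" (is "?h \<in> _")
    and "expectation (\<lambda>\<omega>. H (\<lambda>i\<in>{..k}. measure (\<xi> \<omega>) (C i)) * average M \<xi> A \<omega>) =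
      expectation (\<lambda>\<omega>. H (\<lambda>i\<in>{..k}. measure (\<xi> \<omega>) (C i)) * average M \<xi> (C 0) \<omega>)"
proof -
  show hm[measurable]: "?h \<in> borel_measurable P"
  proof -
    have "(\<lambda>\<omega>. \<lambda>i\<in>{..k}. measure (\<xi> \<omega>) (C i)) \<in> measurable P (\<Pi>\<^sub>M i\<in>{..k}. borel)"
      using C(1) by (intro measurable_restrict measure_xi_measurable) (auto dest: fmeasurableD)
    then show ?thesis by (rule measurable_compose) (rule H)
  qed
  have C0: "C 0 \<in> fmeasurable M" using C(1) by simp
  have Af: "A \<in> fmeasurable M" using A C0 by (metis fmeasurableI2)
  have cpos: "0 < measure M (C 0)"
    using A C0 measure_mono_fmeasurable[OF A(2,1) C0] by simp
  have int: "integrable P (\<lambda>\<omega>. ?h \<omega> * measure (\<xi> \<omega>) E)" if "E \<in> fmeasurable M" for E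
    by (intro integrable_bounded_mult[where K = K] hm Hb integrable_measure that)
  \<comment> \<open>\<open>H + K\<close> is nonnegative, so the previous lemma applies to it. The
    contribution of the constant \<open>K\<close> is then removed by applying that lemma to the
    constant test function 1.\<close>
  have shift: "expectation (\<lambda>\<omega>. (?h \<omega> + K) * measure (\<xi> \<omega>) E) =
      expectation (\<lambda>\<omega>. ?h \<omega> * measure (\<xi> \<omega>) E) + K * expectation (\<lambda>\<omega>. measure (\<xi> \<omega>) E)"
    if "E \<in> fmeasurable M" for E
    using int[OF that] integrable_measure[OF that] by (simp add: distrib_right)
  have "measure M (C 0) * expectation (\<lambda>\<omega>. (?h \<omega> + K) * measure (\<xi> \<omega>) A) =
      measure M A * expectation (\<lambda>\<omega>. (?h \<omega> + K) * measure (\<xi> \<omega>) (C 0))"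
  proof (rule expectation_mult_proportional_nonneg[where H = "\<lambda>x. H x + K" and K = "2 * K"])
    show "0 \<le> H x + K" "H x + K \<le> 2 * K" for x using Hb[of x] by (simp_all add: abs_le_iff)
  qed (use C A in auto)
  moreover have "measure M (C 0) * expectation (\<lambda>\<omega>. 1 * measure (\<xi> \<omega>) A) =
      measure M A * expectation (\<lambda>\<omega>. 1 * measure (\<xi> \<omega>) (C 0))"
    using C A(1,2) by (intro expectation_mult_proportional_nonneg[where H = "\<lambda>_. 1" and K = 1]) auto
  ultimately have "measure M (C 0) * expectation (\<lambda>\<omega>. ?h \<omega> * measure (\<xi> \<omega>) A) =
      measure M A * expectation (\<lambda>\<omega>. ?h \<omega> * measure (\<xi> \<omega>) (C 0))"
    unfolding shift[OF Af] shift[OF C0] by (simp add: algebra_simps)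
  then show "expectation (\<lambda>\<omega>. ?h \<omega> * average M \<xi> A \<omega>) = expectation (\<lambda>\<omega>. ?h \<omega> * average M \<xi> (C 0) \<omega>)"
    using cpos A(3) by (simp add: average_def field_simps)
qed

text \<open>The form used below: under a test function that sees only the chain, the deviation of
  the larger set \<open>C 0\<close> from a fixed \<open>D\<close> may be exchanged for that of the
  smaller set \<open>A\<close>.\<close>

lemma expectation_mult_average_diff_eq:
  fixes H :: "(nat \<Rightarrow> real) \<Rightarrow> real"
  assumes C: "\<And>i. i \<le> k \<Longrightarrow> C i \<in> fmeasurable M" "\<And>i j. i \<le> j \<Longrightarrow> j \<le> k \<Longrightarrow> C i \<subseteq> C j"
    and H: "H \<in> borel_measurable (\<Pi>\<^sub>M i\<in>{..k}. borel)" "\<And>x. \<bar>H x\<bar> \<le> K"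
    and A: "A \<in> sets M" "A \<subseteq> C 0" "0 < measure M A" and D: "D \<in> fmeasurable M"
    and h: "\<And>\<omega>. h \<omega> = H (\<lambda>i\<in>{..k}. measure (\<xi> \<omega>) (C i))"
  shows "expectation (\<lambda>\<omega>. h \<omega> * (average M \<xi> (C 0) \<omega> - average M \<xi> D \<omega>)) =
    expectation (\<lambda>\<omega>. h \<omega> * (average M \<xi> A \<omega> - average M \<xi> D \<omega>))"
proof -
  note eq = expectation_mult_average_eq[where C = C and k = k and H = H, OF C H A, folded h]
  have C0: "C 0 \<in> fmeasurable M" using C(1) by simp
  have Af: "A \<in> fmeasurable M" using A C0 by (metis fmeasurableI2)
  have hb: "\<bar>h \<omega>\<bar> \<le> K" for \<omega>
    unfolding h by (rule H(2))
  have int: "integrable P (\<lambda>\<omega>. h \<omega> * average M \<xi> E \<omega>)" if "E \<in> fmeasurable M" for E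
    by (intro integrable_bounded_mult[where K = K] integrable_average that eq(1) hb)
  show ?thesis
    using int[OF C0] int[OF Af] int[OF D] eq(2) by (simp add: right_diff_distrib)
qed

text \<open>Conditional Jensen inequality without conditioning: the sign of the deviation of
  \<open>C\<close> from \<open>D\<close> is a function of the values on the chain \<open>C\<close>,
  \<open>D\<close>. Tested against it, the deviation of \<open>A\<close> has the expectation on the
  left, and it cannot exceed its own absolute value.\<close>

lemma L1_distance_antimono:
  assumes A: "A \<in> sets M" "A \<subseteq> C" "0 < measure M A"
    and C: "C \<in> fmeasurable M" "C \<subseteq> D" and D: "D \<in> fmeasurable M"
  shows "expectation (\<lambda>\<omega>. \<bar>average M \<xi> C \<omega> - average M \<xi> D \<omega>\<bar>)
    \<le> expectation (\<lambda>\<omega>. \<bar>average M \<xi> A \<omega> - average M \<xi> D \<omega>\<bar>)"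
proof -
  define h where "h \<omega> = sgn (average M \<xi> C \<omega> - average M \<xi> D \<omega>)" for \<omega>
  define B where "B i = (if i = (0::nat) then C else D)" for i
  define H where "H x = sgn (x 0 / measure M C - x 1 / measure M D)" for x :: "nat \<Rightarrow> real"
  have Af: "A \<in> fmeasurable M" using A C by (metis fmeasurableI2)
  have [measurable]: "(\<lambda>x. x i) \<in> borel_measurable (\<Pi>\<^sub>M i\<in>{..1}. borel :: real measure)" if "i \<le> 1" for i :: nat
    using that by (intro measurable_component_singleton) simp
  have Hm: "H \<in> borel_measurable (\<Pi>\<^sub>M i\<in>{..1}. borel)"
    unfolding H_def by measurable
  have hm: "h \<in> borel_measurable P"
    unfolding h_def using fmeasurableD[OF C(1)] fmeasurableD[OF D] by measurable
  have "expectation (\<lambda>\<omega>. \<bar>average M \<xi> C \<omega> - average M \<xi> D \<omega>\<bar>) =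
      expectation (\<lambda>\<omega>. h \<omega> * (average M \<xi> (B 0) \<omega> - average M \<xi> D \<omega>))"
    by (simp add: h_def B_def abs_sgn mult.commute)
  also have "\<dots> = expectation (\<lambda>\<omega>. h \<omega> * (average M \<xi> A \<omega> - average M \<xi> D \<omega>))"
    using A C D Hm
    by (intro expectation_mult_average_diff_eq[where k = 1 and H = H and K = 1])
      (auto simp: B_def H_def h_def average_def sgn_if)
  also have "\<dots> \<le> expectation (\<lambda>\<omega>. \<bar>average M \<xi> A \<omega> - average M \<xi> D \<omega>\<bar>)"
  proof (rule integral_mono)
    show "integrable P (\<lambda>\<omega>. h \<omega> * (average M \<xi> A \<omega> - average M \<xi> D \<omega>))"
      using Af D by (intro integrable_bounded_mult[where K = 1] hm Bochner_Integration.integrable_diff integrable_average)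
        (auto simp: h_def sgn_if)
    show "integrable P (\<lambda>\<omega>. \<bar>average M \<xi> A \<omega> - average M \<xi> D \<omega>\<bar>)"
      by (intro integrable_abs Bochner_Integration.integrable_diff integrable_average Af D)
  qed (auto simp: h_def sgn_if)
  finally show ?thesis .
qed

text \<open>Doob's argument: split according to the last index at which the deviation exceeds e.\<close>

lemma maximal_inequality:
  assumes A: "\<And>n. A n \<in> fmeasurable M" "incseq A" and pos: "0 < measure M (A n)"
    and "n \<le> N" and e: "e > 0"
  shows "e * prob {\<omega>\<in>space P. \<exists>k\<in>{n..N}. \<bar>average M \<xi> (A k) \<omega> - average M \<xi> (A N) \<omega>\<bar> > e}
    \<le> expectation (\<lambda>\<omega>. \<bar>average M \<xi> (A n) \<omega> - average M \<xi> (A N) \<omega>\<bar>)"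
proof -
  define D where "D k \<omega> = average M \<xi> (A k) \<omega> - average M \<xi> (A N) \<omega>" for k \<omega>
  have Dint: "integrable P (D k)" for k
    unfolding D_def by (intro Bochner_Integration.integrable_diff integrable_average A)
  then have [measurable]: "D k \<in> borel_measurable P" for k by auto
  \<comment> \<open>Taking the last large deviation makes \<open>T k\<close> depend only on the
    values on \<open>A k\<close> and larger sets, as the reversed martingale property requires; the
    first one would not.\<close>
  define T where "T k = {\<omega>\<in>space P. \<bar>D k \<omega>\<bar> > e \<and> (\<forall>j\<in>{k<..N}. \<bar>D j \<omega>\<bar> \<le> e)}" for k
  have T[measurable]: "T k \<in> events" for k unfolding T_def by measurable
  have Tdis: "disjoint_family_on T {n..N}"
    unfolding disjoint_family_on_def
  proof (intro ballI impI)
    have "T i \<inter> T j = {}" if "i < j" "j \<le> N" for i j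
      using that by (auto simp: T_def not_less[symmetric])
    then show "T i \<inter> T j = {}" if "i \<in> {n..N}" "j \<in> {n..N}" "i \<noteq> j" for i j
      using that by (metis Int_commute atLeastAtMost_iff linorder_neqE_nat)
  qed
  have cover: "{\<omega>\<in>space P. \<exists>k\<in>{n..N}. \<bar>D k \<omega>\<bar> > e} \<subseteq> (\<Union>k\<in>{n..N}. T k)"
  proof
    fix \<omega> assume w: "\<omega> \<in> {\<omega>\<in>space P. \<exists>k\<in>{n..N}. \<bar>D k \<omega>\<bar> > e}"
    define S where "S = {k\<in>{n..N}. \<bar>D k \<omega>\<bar> > e}"
    have S: "finite S" "S \<noteq> {}" using w by (auto simp: S_def)
    have "\<bar>D j \<omega>\<bar> \<le> e" if "j \<in> {Max S<..N}" for j
    proof (rule ccontr)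
      assume "\<not> \<bar>D j \<omega>\<bar> \<le> e"
      then have "j \<in> S" using that Max_in[OF S] by (auto simp: S_def)
      then show False using Max_ge[OF S(1), of j] that by auto
    qed
    moreover have "Max S \<in> S" by (rule Max_in[OF S])
    ultimately have "\<omega> \<in> T (Max S)" "Max S \<in> {n..N}" using w by (auto simp: T_def S_def)
    then show "\<omega> \<in> (\<Union>k\<in>{n..N}. T k)" by blast
  qed
  have step: "e * prob (T k) \<le> expectation (\<lambda>\<omega>. indicator (T k) \<omega> * \<bar>D n \<omega>\<bar>)" if k: "k \<in> {n..N}" for k
  proof -
    \<comment> \<open>\<open>d\<close> and \<open>H\<close> express the deviations and the test
      function \<open>h\<close> through the values on the chain.\<close>
    define d where "d x j = x j / measure M (A j) - x N / measure M (A N)" for x :: "nat \<Rightarrow> real" and j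
    define H where "H x = (if \<bar>d x k\<bar> > e \<and> (\<forall>j\<in>{k<..N}. \<bar>d x j\<bar> \<le> e) then sgn (d x k) else 0)" for x
    define h where "h \<omega> = (if \<bar>D k \<omega>\<bar> > e \<and> (\<forall>j\<in>{k<..N}. \<bar>D j \<omega>\<bar> \<le> e) then sgn (D k \<omega>) else 0)" for \<omega>
    have hm: "h \<in> borel_measurable P" unfolding h_def by measurable
    have hb: "\<bar>h \<omega>\<bar> \<le> 1" for \<omega> by (simp add: h_def sgn_if)
    have comp: "(\<lambda>x. x i) \<in> borel_measurable (\<Pi>\<^sub>M i\<in>{..N}. borel :: real measure)" if "i \<le> N" for i :: nat
      using that by (intro measurable_component_singleton) simp
    have dm: "(\<lambda>x. d x j) \<in> borel_measurable (\<Pi>\<^sub>M i\<in>{..N}. borel)" if "j \<le> N" for j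
      unfolding d_def by (intro borel_measurable_diff borel_measurable_divide comp that borel_measurable_const order_refl)
    have Hm: "H \<in> borel_measurable (\<Pi>\<^sub>M i\<in>{..N}. borel)"
    proof -
      have [measurable]: "(\<lambda>x. d x k) \<in> borel_measurable (\<Pi>\<^sub>M i\<in>{..N}. borel)"
        using dm k by simp
      have [measurable]: "Measurable.pred (\<Pi>\<^sub>M i\<in>{..N}. borel) (\<lambda>x. \<forall>j\<in>{k<..N}. \<bar>d x j\<bar> \<le> e)"
      proof (rule pred_intros_finite(3))
        fix j assume "j \<in> {k<..N}"
        then have [measurable]: "(\<lambda>x. d x j) \<in> borel_measurable (\<Pi>\<^sub>M i\<in>{..N}. borel)"
          using dm by simp
        show "Measurable.pred (\<Pi>\<^sub>M i\<in>{..N}. borel) (\<lambda>x. \<bar>d x j\<bar> \<le> e)" by measurable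
      qed simp
      show ?thesis unfolding H_def by measurable
    qed
    \<comment> \<open>A chain indexed from 0 with smallest set \<open>A k\<close> that agrees with
      \<open>A\<close> from index \<open>k\<close> on, so that no indices need to be
      shifted.\<close>
    define B where "B i = A (max k i)" for i
    have "d (\<lambda>i\<in>{..N}. measure (\<xi> \<omega>) (B i)) j = D j \<omega>" if "j \<in> {k..N}" for j \<omega>
      using that k by (auto simp: d_def B_def D_def average_def max_def)
    then have hH: "h \<omega> = H (\<lambda>i\<in>{..N}. measure (\<xi> \<omega>) (B i))" for \<omega>
      using k by (auto simp: h_def H_def)
    have B0: "B 0 = A k" by (simp add: B_def)
    \<comment> \<open>The deviation at \<open>k\<close> is exchanged for the one at the starting
      index \<open>n\<close>, so that the bounds for all \<open>k\<close> add up over disjoint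
      events to an integral of the same \<open>D n\<close>.\<close>
    have hD: "expectation (\<lambda>\<omega>. h \<omega> * D k \<omega>) = expectation (\<lambda>\<omega>. h \<omega> * D n \<omega>)"
      unfolding D_def B0[symmetric]
    proof (rule expectation_mult_average_diff_eq[where C = B and H = H and K = 1, OF _ _ Hm _ _ _ pos A(1) hH])
      show "B i \<subseteq> B j" if "i \<le> j" for i j
        using A(2) that by (auto simp: B_def incseq_def)
      show "A n \<subseteq> B 0" using A(2) k by (auto simp: B_def incseq_def)
      show "\<bar>H x\<bar> \<le> 1" for x by (simp add: H_def sgn_if)
    qed (use A(1) in \<open>auto simp: B_def fmeasurableD\<close>)
    have "e * prob (T k) = expectation (\<lambda>\<omega>. e * indicator (T k) \<omega>)" by simp
    also have "\<dots> \<le> expectation (\<lambda>\<omega>. h \<omega> * D k \<omega>)"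
    proof (rule integral_mono)
      show "integrable P (\<lambda>\<omega>. h \<omega> * D k \<omega>)" by (intro integrable_bounded_mult[where K = 1] hm hb Dint)
      show "e * indicator (T k) \<omega> \<le> h \<omega> * D k \<omega>" if "\<omega> \<in> space P" for \<omega>
        using that e by (auto simp: h_def T_def indicator_def sgn_if)
    qed (simp add: integrable_real_indicator less_top[symmetric])
    also have "\<dots> \<le> expectation (\<lambda>\<omega>. indicator (T k) \<omega> * \<bar>D n \<omega>\<bar>)"
      unfolding hD
    proof (rule integral_mono)
      show "integrable P (\<lambda>\<omega>. h \<omega> * D n \<omega>)" by (intro integrable_bounded_mult[where K = 1] hm hb Dint)
      show "integrable P (\<lambda>\<omega>. indicator (T k) \<omega> * \<bar>D n \<omega>\<bar>)"
        by (intro integrable_bounded_mult[where K = 1] integrable_abs Dint) (auto simp: indicator_def)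
      show "h \<omega> * D n \<omega> \<le> indicator (T k) \<omega> * \<bar>D n \<omega>\<bar>" if "\<omega> \<in> space P" for \<omega>
        using that e by (auto simp: h_def T_def indicator_def sgn_if)
    qed
    finally show ?thesis .
  qed
  have "prob {\<omega>\<in>space P. \<exists>k\<in>{n..N}. \<bar>D k \<omega>\<bar> > e} \<le> prob (\<Union>k\<in>{n..N}. T k)"
    using cover by (intro finite_measure_mono) auto
  also have "\<dots> \<le> (\<Sum>k\<in>{n..N}. prob (T k))"
    by (intro finite_measure_subadditive_finite) auto
  finally have "e * prob {\<omega>\<in>space P. \<exists>k\<in>{n..N}. \<bar>D k \<omega>\<bar> > e} \<le> (\<Sum>k\<in>{n..N}. e * prob (T k))"
    using e by (simp add: sum_distrib_left[symmetric])
  also have "\<dots> \<le> (\<Sum>k\<in>{n..N}. expectation (\<lambda>\<omega>. indicator (T k) \<omega> * \<bar>D n \<omega>\<bar>))"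
    by (intro sum_mono step)
  also have "\<dots> = expectation (\<lambda>\<omega>. \<Sum>k\<in>{n..N}. indicator (T k) \<omega> * \<bar>D n \<omega>\<bar>)"
    by (intro Bochner_Integration.integral_sum[symmetric] integrable_bounded_mult[where K = 1] integrable_abs Dint)
      (auto simp: indicator_def)
  also have "\<dots> = expectation (\<lambda>\<omega>. indicator (\<Union>k\<in>{n..N}. T k) \<omega> * \<bar>D n \<omega>\<bar>)"
    using Tdis by (simp add: indicator_UN_disjoint sum_distrib_right)
  also have "\<dots> \<le> expectation (\<lambda>\<omega>. \<bar>D n \<omega>\<bar>)"
  proof (rule integral_mono)
    show "integrable P (\<lambda>\<omega>. indicator (\<Union>k\<in>{n..N}. T k) \<omega> * \<bar>D n \<omega>\<bar>)"
      by (intro integrable_bounded_mult[where K = 1] integrable_abs Dint) (auto simp: indicator_def)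
  qed (auto simp: Dint indicator_def)
  finally show ?thesis unfolding D_def .
qed

subsection \<open>Rate of convergence in L1\<close>

text \<open>Cut \<open>A\<close> and \<open>D - A\<close> into pieces of the measure of
  \<open>U\<close>, those of \<open>A\<close> numbered first. The averages over \<open>A\<close> and
  \<open>D\<close> are then the averages of the first \<open>p\<close> and of all \<open>r\<close>
  piece values, and exchangeability gives all pieces one truncation cost and one square moment, and
  all pairs one mixed moment.\<close>

lemma L1_distance_multiples_le:
  fixes K :: real
  assumes A: "A \<in> sets M" "A \<subseteq> D" and D: "D \<in> fmeasurable M"
    and pr: "0 < p" "p < r" and mA: "measure M A = real p * measure M U" and mD: "measure M D = real r * measure M U"
    and K: "0 \<le> K"
  shows "expectation (\<lambda>\<omega>. \<bar>average M \<xi> A \<omega> - average M \<xi> D \<omega>\<bar>)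
    \<le> 2 * expectation (\<lambda>\<omega>. average M \<xi> U \<omega> - min (average M \<xi> U \<omega>) K) + K / sqrt p"
proof -
  define u where "u = measure M U"
  have u: "0 < u" using U_pos by (simp add: u_def)
  have Af: "A \<in> fmeasurable M" using A D by (metis fmeasurableI2)
  have mDA: "measure M (D - A) = real (r - p) * u"
    using measurable_measure_Diff[OF D A] pr by (simp add: mA mD u_def of_nat_diff left_diff_distrib)
  have DAf: "D - A \<in> fmeasurable M" using D A(1) by (rule fmeasurable_Diff)
  have "1 \<le> r - p" using pr by simp
  then obtain V2 where V2: "\<forall>i<r-p. V2 i \<in> fmeasurable M \<and> measure M (V2 i) = u"
      "disjoint_family_on V2 {..<r-p}" "(\<Union>i<r-p. V2 i) = D - A"
    using atomless_partition[OF atl _ DAf mDA less_imp_le[OF u]] by blast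
  obtain V1 where V1: "\<forall>i<p. V1 i \<in> fmeasurable M \<and> measure M (V1 i) = u"
      "disjoint_family_on V1 {..<p}" "(\<Union>i<p. V1 i) = A"
    using atomless_partition[OF atl, of p A u] u pr Af by (auto simp: mA u_def)
  define V where "V i = (if i < p then V1 i else V2 (i - p))" for i
  have V: "V i \<in> fmeasurable M" "measure M (V i) = u" if "i < r" for i
    using V1(1) V2(1) that by (auto simp: V_def)
  have Vs: "V i \<in> sets M" if "i < r" for i using V(1)[OF that] by (rule fmeasurableD)
  have VA: "(\<Union>i<p. V i) = A" using V1(3) by (auto simp: V_def)
  have "(\<Union>i\<in>{p..<r}. V i) = (\<Union>i<r-p. V2 i)"
  proof (intro equalityI UN_least)
    show "V i \<subseteq> (\<Union>i<r-p. V2 i)" if "i \<in> {p..<r}" for i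
      using that by (auto simp: V_def intro!: bexI[of _ "i - p"])
    show "V2 i \<subseteq> (\<Union>i\<in>{p..<r}. V i)" if "i \<in> {..<r-p}" for i
      using that by (auto simp: V_def intro!: bexI[of _ "i + p"])
  qed
  then have VDA: "(\<Union>i\<in>{p..<r}. V i) = D - A" using V2(3) by simp
  have "{..<r} = {..<p} \<union> {p..<r}" using pr by auto
  then have VD: "(\<Union>i<r. V i) = D" using VA VDA A(2) by auto
  have Vij: "V i \<inter> V j = {}" if "i < j" "j < r" for i j
  proof (cases "j < p")
    case True
    then show ?thesis using disjoint_family_onD[OF V1(2), of i j] that by (simp add: V_def)
  next
    case j: False
    show ?thesis
    proof (cases "i < p")
      case True
      then have "V i \<subseteq> A" using VA by auto
      moreover have "V j \<subseteq> D - A" using VDA j that by auto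
      ultimately show ?thesis by auto
    next
      case False
      then show ?thesis using disjoint_family_onD[OF V2(2), of "i - p" "j - p"] j that by (simp add: V_def)
    qed
  qed
  then have Vij: "V i \<inter> V j = {}" if "i \<noteq> j" "i < r" "j < r" for i j
    using that by (metis Int_commute linorder_neqE_nat)
  define W where "W i \<omega> = average M \<xi> (V i) \<omega>" for i \<omega>
  have Wu: "W i \<omega> = measure (\<xi> \<omega>) (V i) / u" if "i < r" for i \<omega>
    using V(2)[OF that] by (simp add: W_def average_def)
  define f where "f x = min (x / u) K" for x
  have fm: "f \<in> borel_measurable borel" unfolding f_def by measurable
  \<comment> \<open>Pieces 0 and 1 represent all pairs; both exist because \<open>0 < p < r\<close>
    forces \<open>r\<close> to be at least 2.\<close>
  define c where "c = expectation (\<lambda>\<omega>. f (measure (\<xi> \<omega>) (V 0)) * f (measure (\<xi> \<omega>) (V 1)))"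
  define \<delta> where "\<delta> = expectation (\<lambda>\<omega>. average M \<xi> U \<omega> - min (average M \<xi> U \<omega>) K)"
  have "expectation (\<lambda>\<omega>. \<bar>(\<Sum>i<p. W i \<omega>) / p - (\<Sum>i<r. W i \<omega>) / r\<bar>) \<le> 2 * \<delta> + K / sqrt p"
  proof (rule expectation_abs_diff_averages_le[where c = c])
    show "integrable P (W i)" if "i < r" for i
      unfolding W_def using integrable_average[OF V(1)[OF that]] by simp
    show "0 \<le> W i \<omega>" for i \<omega> by (simp add: W_def average_def)
    show "expectation (\<lambda>\<omega>. W i \<omega> - min (W i \<omega>) K) \<le> \<delta>" if "i < r" for i
      using expectation_measure_eq[OF V(1)[OF that] U, of "\<lambda>x. x / u - min (x / u) K"] V(2)[OF that] that
      by (simp add: \<delta>_def average_def Wu u_def)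
    show "0 \<le> \<delta>" unfolding \<delta>_def by (intro integral_nonneg_AE) simp
    show "expectation (\<lambda>\<omega>. min (W i \<omega>) K * min (W j \<omega>) K) = c" if "i < r" "j < r" "i \<noteq> j" for i j
    proof -
      have "1 < r" using pr by simp
      then show ?thesis
        using expectation_mult_measure_eq[of "V i" "V j" "V 0" "V 1" f] V Vij fm that
        by (simp add: c_def Wu f_def)
    qed
    show "expectation (\<lambda>\<omega>. min (W i \<omega>) K * min (W i \<omega>) K) = expectation (\<lambda>\<omega>. min (average M \<xi> U \<omega>) K * min (average M \<xi> U \<omega>) K)"
      if "i < r" for i
      using expectation_measure_eq[OF V(1)[OF that] U, of "\<lambda>x. min (x / u) K * min (x / u) K"] V(2)[OF that] that
      by (simp add: average_def Wu u_def)
    show "0 \<le> c" unfolding c_def f_def using u K by (intro integral_nonneg_AE) simp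
  qed (use pr K in auto)
  moreover have "expectation (\<lambda>\<omega>. \<bar>average M \<xi> A \<omega> - average M \<xi> D \<omega>\<bar>) =
      expectation (\<lambda>\<omega>. \<bar>(\<Sum>i<p. W i \<omega>) / p - (\<Sum>i<r. W i \<omega>) / r\<bar>)"
  proof (rule integral_cong_AE)
    show "AE \<omega> in P. \<bar>average M \<xi> A \<omega> - average M \<xi> D \<omega>\<bar> = \<bar>(\<Sum>i<p. W i \<omega>) / p - (\<Sum>i<r. W i \<omega>) / r\<bar>"
      using AE_space AE_fmeasurable[OF D]
    proof eventually_elim
      case (elim \<omega>)
      have sum: "measure (\<xi> \<omega>) (\<Union>i<n. V i) = (\<Sum>i<n. measure (\<xi> \<omega>) (V i))" if "n \<le> r" for n
      proof (rule measure_finite_Union)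
        show "disjoint_family_on V {..<n}" unfolding disjoint_family_on_def using Vij that by auto
        show "V ` {..<n} \<subseteq> sets (\<xi> \<omega>)" using Vs that sets_xi[OF elim(1)] by auto
        show "emeasure (\<xi> \<omega>) (V i) \<noteq> \<infinity>" if i: "i \<in> {..<n}" for i
        proof -
          have "i < r" using i \<open>n \<le> r\<close> by simp
          then have "V i \<subseteq> D" "V i \<in> sets (\<xi> \<omega>)" using VD Vs sets_xi[OF elim(1)] by auto
          from fmeasurableI2[OF elim(2) this] show ?thesis by (simp add: fmeasurableD2)
        qed
      qed simp
      have "(\<Sum>i<p. W i \<omega>) / p = measure (\<xi> \<omega>) A / (p * u)"
        using sum[of p] pr by (simp add: VA Wu sum_divide_distrib[symmetric] mult.commute)
      moreover have "(\<Sum>i<r. W i \<omega>) / r = measure (\<xi> \<omega>) D / (r * u)"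
        using sum[of r] by (simp add: VD Wu sum_divide_distrib[symmetric] mult.commute)
      ultimately show ?case by (simp add: average_def mA mD u_def)
    qed
    have "W i \<in> borel_measurable P" if "i < r" for i
      unfolding W_def using average_measurable[OF Vs[OF that]] by simp
    then show "(\<lambda>\<omega>. \<bar>(\<Sum>i<p. W i \<omega>) / p - (\<Sum>i<r. W i \<omega>) / r\<bar>) \<in> borel_measurable P"
      using pr by (intro borel_measurable_abs borel_measurable_diff borel_measurable_divide borel_measurable_sum) auto
  qed (use A D in \<open>auto intro!: borel_measurable_abs borel_measurable_diff dest: fmeasurableD\<close>)
  ultimately show ?thesis by (simp add: \<delta>_def)
qed

text \<open>The bound for integer multiples of the measure of U carries over to arbitrary measures:
  shrink A and enlarge C to such multiples, and use that the distance is antitone in its first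
  set.\<close>

lemma L1_distance_uniformly_small:
  assumes large: "\<And>t. \<exists>D\<in>fmeasurable M. t \<le> measure M D" and e: "e > 0"
  shows "\<exists>a>0. \<forall>A C. A \<in> sets M \<and> A \<subseteq> C \<and> C \<in> fmeasurable M \<and> a \<le> measure M A \<longrightarrow>
    expectation (\<lambda>\<omega>. \<bar>average M \<xi> A \<omega> - average M \<xi> C \<omega>\<bar>) \<le> e"
proof -
  define u where "u = measure M U"
  have u: "0 < u" using U_pos by (simp add: u_def)
  let ?Y = "average M \<xi> U"
  have Y: "integrable P ?Y" by (rule integrable_average[OF U])
  have Y0: "0 \<le> ?Y \<omega>" for \<omega> by (simp add: average_def)
  have "(\<lambda>n::nat. expectation (\<lambda>\<omega>. ?Y \<omega> - min (?Y \<omega>) (real n))) \<longlonglongrightarrow> expectation (\<lambda>\<omega>. 0)"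
  proof (rule integral_dominated_convergence[where w = ?Y])
    show "AE \<omega> in P. (\<lambda>n. ?Y \<omega> - min (?Y \<omega>) (real n)) \<longlonglongrightarrow> 0"
    proof (rule AE_I2, rule tendsto_eventually)
      fix \<omega>
      show "\<forall>\<^sub>F n in sequentially. ?Y \<omega> - min (?Y \<omega>) (real n) = 0"
        using eventually_ge_at_top[of "nat \<lceil>?Y \<omega>\<rceil>"]
        by eventually_elim (simp add: nat_ceiling_le_eq min_absorb1)
    qed
    show "AE \<omega> in P. norm (?Y \<omega> - min (?Y \<omega>) (real n)) \<le> ?Y \<omega>" for n
      using Y0 by (auto simp: min_def)
  qed (use Y in auto)
  then have "(\<lambda>n::nat. expectation (\<lambda>\<omega>. ?Y \<omega> - min (?Y \<omega>) (real n))) \<longlonglongrightarrow> 0" by simp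
  \<comment> \<open>The truncation cost enters twice, contributing at most \<open>e / 4\<close>, and
    the term with the square root contributes at most \<open>e / 4\<close>. The resulting
    \<open>e / 2\<close> is spent twice in the final triangle inequality through
    \<open>D\<close>.\<close>
  from order_tendstoD(2)[OF this, of "e / 8"] e
  obtain n where n: "expectation (\<lambda>\<omega>. ?Y \<omega> - min (?Y \<omega>) (real n)) < e / 8"
    by (auto simp: eventually_sequentially)
  have "(\<lambda>p. real n / sqrt (real p)) \<longlonglongrightarrow> 0" by real_asymp
  from order_tendstoD(2)[OF this, of "e / 4"] e
  obtain p0 where p0: "\<And>p. p \<ge> p0 \<Longrightarrow> real n / sqrt (real p) < e / 4"
    by (auto simp: eventually_sequentially)
  define p where "p = Suc p0"
  have p: "0 < p" "real n / sqrt (real p) < e / 4" using p0[of p] by (simp_all add: p_def)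
  show ?thesis
  proof (intro exI[of _ "p * u"] conjI allI impI)
    show "0 < p * u" using p u by simp
    fix A C assume AC: "A \<in> sets M \<and> A \<subseteq> C \<and> C \<in> fmeasurable M \<and> p * u \<le> measure M A"
    then have A: "A \<in> sets M" "A \<subseteq> C" and C: "C \<in> fmeasurable M" and pu: "p * u \<le> measure M A" by auto
    have Af: "A \<in> fmeasurable M" using A C by (metis fmeasurableI2)
    obtain A' where A': "A' \<in> sets M" "A' \<subseteq> A" "measure M A' = real p * u"
      using atomless_subset_of_measure[OF atl Af, of "real p * u"] pu u by auto
    obtain r0 :: nat where r0: "measure M C < real r0 * u"
      using reals_Archimedean3[OF u] by blast
    \<comment> \<open>The bound for multiples needs \<open>p < r\<close>, even when \<open>C\<close>
      itself is barely larger than \<open>p * u\<close>.\<close>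
    define r where "r = max r0 (Suc p)"
    have "real r0 * u \<le> real r * u" using u by (intro mult_right_mono) (simp_all add: r_def)
    then have r: "p < r" "measure M C \<le> real r * u" using r0 by (simp_all add: r_def)
    \<comment> \<open>\<open>B\<close> provides the room for enlarging \<open>C\<close> to measure
      exactly \<open>r * u\<close>; the enlargement is cut out of the part of \<open>B\<close>
      outside \<open>C\<close>.\<close>
    obtain B where B: "B \<in> fmeasurable M" "real r * u \<le> measure M B"
      using large by blast
    have BC: "B \<union> C \<in> fmeasurable M" using B C by (intro fmeasurable.Un)
    then have BCf: "(B \<union> C) - C \<in> fmeasurable M" using fmeasurableD[OF C] by (rule fmeasurable_Diff)
    have "measure M B \<le> measure M (B \<union> C)"
      using B BC by (intro measure_mono_fmeasurable) (auto dest: fmeasurableD)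
    then have "real r * u - measure M C \<le> measure M ((B \<union> C) - C)"
      using measurable_measure_Diff[OF BC fmeasurableD[OF C]] B by simp
    then obtain E where E: "E \<in> sets M" "E \<subseteq> (B \<union> C) - C" "measure M E = real r * u - measure M C"
      using atomless_subset_of_measure[OF atl BCf, of "real r * u - measure M C"] r by auto
    have Ef: "E \<in> fmeasurable M" using BCf E by (metis fmeasurableI2)
    define D where "D = C \<union> E"
    have D: "D \<in> fmeasurable M" unfolding D_def using C Ef by (rule fmeasurable.Un)
    have "measure M D = measure M C + measure M E"
      unfolding D_def using C Ef E(2) by (intro measure_Union) (auto simp: fmeasurable_def)
    then have mD: "measure M D = real r * u" using E(3) by simp
    have CD: "C \<subseteq> D" by (auto simp: D_def)
    let ?d = "\<lambda>A B. expectation (\<lambda>\<omega>. \<bar>average M \<xi> A \<omega> - average M \<xi> B \<omega>\<bar>)"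
    have A'pos: "0 < measure M A'" using A'(3) p u by simp
    have "?d A' D \<le> 2 * expectation (\<lambda>\<omega>. ?Y \<omega> - min (?Y \<omega>) (real n)) + real n / sqrt p"
      using A' A(2) CD D p(1) r(1) mD by (intro L1_distance_multiples_le[where r = r]) (auto simp: u_def)
    then have A'D: "?d A' D \<le> e / 2" using n p(2) by linarith
    have "?d A D \<le> ?d A' D"
      using A A' A'pos Af CD D by (intro L1_distance_antimono) auto
    moreover have "?d C D \<le> ?d A' D"
      using A A' A'pos C CD D by (intro L1_distance_antimono) auto
    moreover have "?d A C \<le> ?d A D + ?d C D"
    proof -
      have i: "integrable P (\<lambda>\<omega>. \<bar>average M \<xi> F \<omega> - average M \<xi> G \<omega>\<bar>)"
        if "F \<in> fmeasurable M" "G \<in> fmeasurable M" for F G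
        by (intro integrable_abs Bochner_Integration.integrable_diff integrable_average that)
      have "?d A C \<le> expectation (\<lambda>\<omega>. \<bar>average M \<xi> A \<omega> - average M \<xi> D \<omega>\<bar> + \<bar>average M \<xi> C \<omega> - average M \<xi> D \<omega>\<bar>)"
        by (intro integral_mono Bochner_Integration.integrable_add i Af C D) linarith
      then show ?thesis using i[OF Af D] i[OF C D] by simp
    qed
    ultimately show "?d A C \<le> e" using A'D by linarith
  qed
qed

end

section \<open>Limits along sequences of sets\<close>

lemma measure_sequenceD:
  assumes "measure_sequence M A"
  shows "A n \<in> fmeasurable M" and "incseq A" and "\<exists>m. \<forall>n\<ge>m. a \<le> measure M (A n)"
proof -
  show fm: "A n \<in> fmeasurable M" for n
    using assms by (simp add: measure_sequence_def fmeasurable_def)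
  show "incseq A" using assms by (simp add: measure_sequence_def)
  have "(\<lambda>n. emeasure M (A n)) \<longlonglongrightarrow> \<infinity>" using assms by (simp add: measure_sequence_def)
  from order_tendstoD(1)[OF this, of "ennreal a"] obtain m where
    "\<And>n. n \<ge> m \<Longrightarrow> ennreal a < emeasure M (A n)" by (auto simp: eventually_sequentially)
  then have "a \<le> measure M (A n)" if "n \<ge> m" for n
    using that emeasure_eq_measure2[OF fm[of n]] by (metis ennreal_le_iff less_imp_le measure_nonneg)
  then show "\<exists>m. \<forall>n\<ge>m. a \<le> measure M (A n)" by blast
qed

lemma measure_sequence_Un:
  assumes "measure_sequence M A" "measure_sequence M B"
  shows "measure_sequence M (\<lambda>n. A n \<union> B n)"
proof -
  have fm: "A n \<union> B n \<in> fmeasurable M" for n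
    using assms by (intro fmeasurable.Un measure_sequenceD)
  have "(\<lambda>n. emeasure M (A n \<union> B n)) \<longlonglongrightarrow> \<infinity>"
    unfolding infinity_ennreal_def tendsto_top_iff_ennreal
  proof (intro allI impI)
    fix a :: real assume "0 \<le> a"
    have "(\<lambda>n. emeasure M (A n)) \<longlonglongrightarrow> top" using assms(1) by (simp add: measure_sequence_def)
    from order_tendstoD(1)[OF this, of "ennreal a", OF ennreal_less_top] show "\<forall>\<^sub>F n in sequentially. ennreal a < emeasure M (A n \<union> B n)"
    proof eventually_elim
      case (elim n)
      then show ?case using fmeasurableD[OF fm[of n]] by (auto elim!: less_le_trans intro!: emeasure_mono)
    qed
  qed
  moreover have "incseq (\<lambda>n. A n \<union> B n)"
    using measure_sequenceD(2)[OF assms(1)] measure_sequenceD(2)[OF assms(2)] by (fastforce simp: incseq_def)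
  ultimately show ?thesis
    using fm by (auto simp: measure_sequence_def fmeasurable_def)
qed

context integrable_exchangeable_random_measure
begin

text \<open>The set \<open>C\<close> ranges over all supersets of finite measure and not only over
  later members of the sequence. The latter give the Cauchy property; the former allow a comparison
  with another sequence.\<close>

lemma measure_sequence_L1_distance_small:
  assumes A: "measure_sequence M A" and e: "e > 0"
  shows "\<exists>m. \<forall>n\<ge>m. \<forall>C\<in>fmeasurable M. A n \<subseteq> C \<longrightarrow>
    expectation (\<lambda>\<omega>. \<bar>average M \<xi> (A n) \<omega> - average M \<xi> C \<omega>\<bar>) \<le> e"
proof -
  have "\<exists>D\<in>fmeasurable M. t \<le> measure M D" for t
    using measure_sequenceD(1,3)[OF A] by blast
  from L1_distance_uniformly_small[OF this e] obtain a where
    "\<And>A C. A \<in> sets M \<Longrightarrow> A \<subseteq> C \<Longrightarrow> C \<in> fmeasurable M \<Longrightarrow> a \<le> measure M A \<Longrightarrow>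
      expectation (\<lambda>\<omega>. \<bar>average M \<xi> A \<omega> - average M \<xi> C \<omega>\<bar>) \<le> e" by blast
  moreover obtain m where "\<And>n. n \<ge> m \<Longrightarrow> a \<le> measure M (A n)"
    using measure_sequenceD(3)[OF A] by blast
  ultimately show ?thesis
    using fmeasurableD[OF measure_sequenceD(1)[OF A]] by (intro exI[of _ m]) simp
qed

lemma averages_converge:
  assumes A: "measure_sequence M A"
  shows "\<exists>X. converges_AE_L1 P (\<lambda>n. average M \<xi> (A n)) X"
proof -
  note fm = measure_sequenceD(1)[OF A] and inc = measure_sequenceD(2)[OF A]
  \<comment> \<open>From \<open>n0\<close> on the sets have positive measure, which the maximal
    inequality requires of its first set.\<close>
  obtain n0 where n0: "\<And>n. n \<ge> n0 \<Longrightarrow> 1 \<le> measure M (A n)"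
    using measure_sequenceD(3)[OF A] by blast
  show ?thesis
  proof (rule converges_AE_L1_if_maximal_inequality)
    show "integrable P (average M \<xi> (A n))" for n by (rule integrable_average[OF fm])
    fix e :: real assume "e > 0"
    from measure_sequence_L1_distance_small[OF A this] obtain m where
      "\<forall>n\<ge>m. \<forall>C\<in>fmeasurable M. A n \<subseteq> C \<longrightarrow>
        expectation (\<lambda>\<omega>. \<bar>average M \<xi> (A n) \<omega> - average M \<xi> C \<omega>\<bar>) \<le> e" ..
    then show "\<exists>m. \<forall>n\<ge>m. \<forall>N\<ge>n. expectation (\<lambda>\<omega>. \<bar>average M \<xi> (A n) \<omega> - average M \<xi> (A N) \<omega>\<bar>) \<le> e"
      using fm incseqD[OF inc] by (intro exI[of _ m]) simp
  next
    show "e * prob {\<omega>\<in>space P. \<exists>k\<in>{n..N}. \<bar>average M \<xi> (A k) \<omega> - average M \<xi> (A N) \<omega>\<bar> > e}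
        \<le> expectation (\<lambda>\<omega>. \<bar>average M \<xi> (A n) \<omega> - average M \<xi> (A N) \<omega>\<bar>)"
      if "n0 \<le> n" "n \<le> N" "e > 0" for n N e
      using n0[OF that(1)] that by (intro maximal_inequality fm inc) auto
  qed
qed

text \<open>The L1 distance of the limits is at most that from \<open>X\<close> to the average over
  \<open>A n\<close>, on to the average over \<open>C n\<close>, and on to \<open>X'\<close>. The
  outer terms tend to 0, and the middle one is eventually at most \<open>e\<close> by the uniform
  rate.\<close>

lemma limits_AE_eq_if_subset:
  assumes A: "measure_sequence M A" and C: "measure_sequence M C" and sub: "\<And>n. A n \<subseteq> C n"
    and X: "converges_AE_L1 P (\<lambda>n. average M \<xi> (A n)) X"
    and X': "converges_AE_L1 P (\<lambda>n. average M \<xi> (C n)) X'"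
  shows "AE \<omega> in P. X \<omega> = X' \<omega>"
proof -
  note fA = measure_sequenceD(1)[OF A] and fC = measure_sequenceD(1)[OF C]
  let ?a = "\<lambda>n. average M \<xi> (A n)" and ?c = "\<lambda>n. average M \<xi> (C n)"
  have int: "integrable P X" "integrable P X'" "\<And>n. integrable P (?a n)" "\<And>n. integrable P (?c n)"
    using X X' by (auto simp: converges_AE_L1_def)
  have small: "expectation (\<lambda>\<omega>. \<bar>X \<omega> - X' \<omega>\<bar>) \<le> 0 + e" if e: "e > 0" for e
  proof (rule LIMSEQ_le_const)
    have "(\<lambda>n. expectation (\<lambda>\<omega>. \<bar>?a n \<omega> - X \<omega>\<bar>) + e + expectation (\<lambda>\<omega>. \<bar>?c n \<omega> - X' \<omega>\<bar>)) \<longlonglongrightarrow> 0 + e + 0"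
      using X X' by (intro tendsto_intros) (auto simp: converges_AE_L1_def)
    then show "(\<lambda>n. expectation (\<lambda>\<omega>. \<bar>?a n \<omega> - X \<omega>\<bar>) + e + expectation (\<lambda>\<omega>. \<bar>?c n \<omega> - X' \<omega>\<bar>)) \<longlonglongrightarrow> 0 + e"
      by simp
    from measure_sequence_L1_distance_small[OF A e] obtain m where
      "\<forall>n\<ge>m. \<forall>C\<in>fmeasurable M. A n \<subseteq> C \<longrightarrow>
        expectation (\<lambda>\<omega>. \<bar>?a n \<omega> - average M \<xi> C \<omega>\<bar>) \<le> e" ..
    then have m: "expectation (\<lambda>\<omega>. \<bar>?a n \<omega> - ?c n \<omega>\<bar>) \<le> e" if "n \<ge> m" for n
      using that fC sub by simp
    have "expectation (\<lambda>\<omega>. \<bar>X \<omega> - X' \<omega>\<bar>)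
        \<le> expectation (\<lambda>\<omega>. \<bar>?a n \<omega> - X \<omega>\<bar>) + e + expectation (\<lambda>\<omega>. \<bar>?c n \<omega> - X' \<omega>\<bar>)" if "n \<ge> m" for n
    proof -
      have "expectation (\<lambda>\<omega>. \<bar>X \<omega> - X' \<omega>\<bar>)
          \<le> expectation (\<lambda>\<omega>. \<bar>?a n \<omega> - X \<omega>\<bar> + \<bar>?a n \<omega> - ?c n \<omega>\<bar> + \<bar>?c n \<omega> - X' \<omega>\<bar>)"
        by (intro integral_mono Bochner_Integration.integrable_add Bochner_Integration.integrable_diff
            integrable_abs int) linarith
      also have "\<dots> = expectation (\<lambda>\<omega>. \<bar>?a n \<omega> - X \<omega>\<bar>) + expectation (\<lambda>\<omega>. \<bar>?a n \<omega> - ?c n \<omega>\<bar>)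
          + expectation (\<lambda>\<omega>. \<bar>?c n \<omega> - X' \<omega>\<bar>)"
        using int by simp
      finally show ?thesis using m[OF that] by linarith
    qed
    then show "\<exists>m. \<forall>n\<ge>m. expectation (\<lambda>\<omega>. \<bar>X \<omega> - X' \<omega>\<bar>)
        \<le> expectation (\<lambda>\<omega>. \<bar>?a n \<omega> - X \<omega>\<bar>) + e + expectation (\<lambda>\<omega>. \<bar>?c n \<omega> - X' \<omega>\<bar>)" by blast
  qed
  have "expectation (\<lambda>\<omega>. \<bar>X \<omega> - X' \<omega>\<bar>) \<le> 0"
    by (rule field_le_epsilon) (rule small)
  moreover have "0 \<le> expectation (\<lambda>\<omega>. \<bar>X \<omega> - X' \<omega>\<bar>)" by (intro integral_nonneg_AE) simp
  ultimately have "AE \<omega> in P. \<bar>X \<omega> - X' \<omega>\<bar> = 0"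
    using int by (subst integral_nonneg_eq_0_iff_AE[symmetric]) auto
  then show ?thesis by simp
qed

lemma limits_AE_eq:
  assumes A: "measure_sequence M A" and B: "measure_sequence M B"
    and X: "converges_AE_L1 P (\<lambda>n. average M \<xi> (A n)) X"
    and X': "converges_AE_L1 P (\<lambda>n. average M \<xi> (B n)) X'"
  shows "AE \<omega> in P. X \<omega> = X' \<omega>"
proof -
  note AB = measure_sequence_Un[OF A B]
  obtain Z where Z: "converges_AE_L1 P (\<lambda>n. average M \<xi> (A n \<union> B n)) Z"
    using averages_converge[OF AB] by blast
  have "AE \<omega> in P. X \<omega> = Z \<omega>" "AE \<omega> in P. X' \<omega> = Z \<omega>"
    using limits_AE_eq_if_subset[OF A AB _ X Z] limits_AE_eq_if_subset[OF B AB _ X' Z] by auto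
  then show ?thesis by eventually_elim simp
qed

text \<open>The limit along one fixed sequence serves for all others; if there is no sequence at
  all, the claim is vacuous.\<close>

lemma ex_common_limit:
  "\<exists>X. \<forall>A. measure_sequence M A \<longrightarrow> integrable_sequence P \<xi> A \<and>
     converges_AE_L1 P (\<lambda>n. average M \<xi> (A n)) X \<and>
     (\<forall>Y. converges_AE_L1 P (\<lambda>n. average M \<xi> (A n)) Y \<longrightarrow> (AE \<omega> in P. Y \<omega> = X \<omega>))"
proof (cases "\<exists>A. measure_sequence M A")
  case True
  then obtain A0 where A0: "measure_sequence M A0" by blast
  obtain X where X: "converges_AE_L1 P (\<lambda>n. average M \<xi> (A0 n)) X"
    using averages_converge[OF A0] by blast
  have Xint: "integrable P X" using X by (simp add: converges_AE_L1_def)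
  have "integrable_sequence P \<xi> A \<and> converges_AE_L1 P (\<lambda>n. average M \<xi> (A n)) X \<and>
     (\<forall>Y. converges_AE_L1 P (\<lambda>n. average M \<xi> (A n)) Y \<longrightarrow> (AE \<omega> in P. Y \<omega> = X \<omega>))"
    if A: "measure_sequence M A" for A
  proof (intro conjI allI impI)
    show "integrable_sequence P \<xi> A"
      using nn_integral_emeasure_finite[OF measure_sequenceD(1)[OF A]] by (simp add: integrable_sequence_def)
    show "AE \<omega> in P. Y \<omega> = X \<omega>" if "converges_AE_L1 P (\<lambda>n. average M \<xi> (A n)) Y" for Y
      using limits_AE_eq[OF A A0 that X] .
    obtain Y where Y: "converges_AE_L1 P (\<lambda>n. average M \<xi> (A n)) Y"
      using averages_converge[OF A] by blast
    have eq: "AE \<omega> in P. Y \<omega> = X \<omega>" using limits_AE_eq[OF A A0 Y X] .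
    have "AE \<omega> in P. (\<lambda>n. average M \<xi> (A n) \<omega>) \<longlonglongrightarrow> Y \<omega>"
      using Y by (simp add: converges_AE_L1_def)
    then have "AE \<omega> in P. (\<lambda>n. average M \<xi> (A n) \<omega>) \<longlonglongrightarrow> X \<omega>"
      using eq by eventually_elim simp
    \<comment> \<open>Both modes of convergence to \<open>Y\<close> pass to \<open>X\<close>, since
      the two agree almost surely.\<close>
    moreover have "expectation (\<lambda>\<omega>. \<bar>average M \<xi> (A n) \<omega> - Y \<omega>\<bar>) = expectation (\<lambda>\<omega>. \<bar>average M \<xi> (A n) \<omega> - X \<omega>\<bar>)" for n
    proof (rule integral_cong_AE)
      show "AE \<omega> in P. \<bar>average M \<xi> (A n) \<omega> - Y \<omega>\<bar> = \<bar>average M \<xi> (A n) \<omega> - X \<omega>\<bar>"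
        using eq by eventually_elim simp
    qed (use Xint Y integrable_average[OF measure_sequenceD(1)[OF A]] in \<open>auto simp: converges_AE_L1_def\<close>)
    ultimately show "converges_AE_L1 P (\<lambda>n. average M \<xi> (A n)) X"
      using Y Xint by (simp add: converges_AE_L1_def)
  qed
  then show ?thesis by blast
qed blast

end

theorem theorem4p11:
  fixes P :: "'w measure" and M :: "'a measure" and \<xi> :: "'w \<Rightarrow> 'a measure"
  assumes "prob_space P"
    and "atomless M"
    and "random_measure P M \<xi>"
    and "exchangeable P M \<xi>"
  shows "(\<forall>A. measure_sequence M A \<and> integrable_sequence P \<xi> A \<longrightarrow>
            (\<exists>X. converges_AE_L1 P (\<lambda>n. average M \<xi> (A n)) X)) \<and>
         (sigma_finite_measure M \<and>
          (\<exists>C\<in>sets M. 0 < emeasure M C \<and> emeasure M C < \<infinity> \<and>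
             (\<integral>\<^sup>+\<omega>. emeasure (\<xi> \<omega>) C \<partial>P) < \<infinity>) \<longrightarrow>
          (\<exists>X. \<forall>A. measure_sequence M A \<longrightarrow>
             integrable_sequence P \<xi> A \<and>
             converges_AE_L1 P (\<lambda>n. average M \<xi> (A n)) X \<and>
             (\<forall>Y. converges_AE_L1 P (\<lambda>n. average M \<xi> (A n)) Y \<longrightarrow> (AE \<omega> in P. Y \<omega> = X \<omega>))))"
proof -
  interpret prob_space P by fact
  have L: "integrable_exchangeable_random_measure P M \<xi> C"
    if "C \<in> fmeasurable M" "0 < measure M C" "(\<integral>\<^sup>+\<omega>. emeasure (\<xi> \<omega>) C \<partial>P) < \<infinity>" for C
    using that assms by unfold_locales
  show ?thesis
  proof (intro conjI allI impI; elim conjE)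
    fix A assume A: "measure_sequence M A" and "integrable_sequence P \<xi> A"
    \<comment> \<open>A member of the sequence of measure at least 1 becomes the reference set; its
      expectation is finite by integrability of the sequence.\<close>
    obtain m where m: "1 \<le> measure M (A m)"
      using measure_sequenceD(3)[OF A] by blast
    have "integrable_exchangeable_random_measure P M \<xi> (A m)"
    proof (rule L)
      show "A m \<in> fmeasurable M" by (rule measure_sequenceD(1)[OF A])
      show "0 < measure M (A m)" using m by simp
      show "(\<integral>\<^sup>+\<omega>. emeasure (\<xi> \<omega>) (A m) \<partial>P) < \<infinity>"
        using \<open>integrable_sequence P \<xi> A\<close> by (simp add: integrable_sequence_def)
    qed
    then show "\<exists>X. converges_AE_L1 P (\<lambda>n. average M \<xi> (A n)) X"
      by (rule integrable_exchangeable_random_measure.averages_converge[OF _ A])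
  next
    assume "\<exists>C\<in>sets M. 0 < emeasure M C \<and> emeasure M C < \<infinity> \<and> (\<integral>\<^sup>+\<omega>. emeasure (\<xi> \<omega>) C \<partial>P) < \<infinity>"
    then obtain C where C: "C \<in> sets M" "0 < emeasure M C" "emeasure M C < \<infinity>"
      "(\<integral>\<^sup>+\<omega>. emeasure (\<xi> \<omega>) C \<partial>P) < \<infinity>" by blast
    \<comment> \<open>Here the given set \<open>C\<close> itself is the reference set.\<close>
    have "C \<in> fmeasurable M" using C by (simp add: fmeasurable_def)
    moreover from this have "0 < measure M C"
      using C(2) emeasure_eq_measure2[of C M] by (simp add: zero_less_measure_iff)
    ultimately show "\<exists>X. \<forall>A. measure_sequence M A \<longrightarrow>
             integrable_sequence P \<xi> A \<and>
             converges_AE_L1 P (\<lambda>n. average M \<xi> (A n)) X \<and>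
             (\<forall>Y. converges_AE_L1 P (\<lambda>n. average M \<xi> (A n)) Y \<longrightarrow> (AE \<omega> in P. Y \<omega> = X \<omega>))"
      using C(4) by (intro integrable_exchangeable_random_measure.ex_common_limit[OF L])
  qed
qed

end
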